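(* Let $0\le\sigma^2<\rho+2b$ and consider the equation $$\rho V-(r(x)-bx)V_x+\ln(-V_x)+cx^2+1-\tfrac12\sigma^2x^2V_{xx}=0. \qquad(\ast)$$ Assume that (a) $u\in C([0,\infty))$ is a strictly decreasing viscosity subsolution of $(\ast)$ in $[0,\infty)$, with $Du\le-\frac1{c_1}$ in the viscosity sense for some positive constant $c_1$; (b) $v\in C([0,\infty))$ is a strictly decreasing viscosity supersolution of $(\ast)$ in $(0,\infty)$ such that $v(x)\ge -c_2(1+x^q)$ for all $x\ge0$, where $c_2$ is some positive constant and $q$ is some real number strictly smaller than $|k(\sigma)|$; here $k(0)=+\infty$ and, for $\sigma>0$, $k(\sigma)$ is the negative root of $$k^2+\Big(1+\frac{2b}{\sigma^2}\Big)k-\frac{2\rho}{\sigma^2}=0 .$$ Then $u\le v$ in $[0,\infty)$.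
   Context: The parameters satisfy $b,c,\rho>0$, $\sigma\ge0$. The function $r$ is a sigmoid function satisfying: (1) $r\in C^1([0,\infty))$ is non-decreasing; (2) $r(0)=0$ and $r(x)\le (b+\rho)x$ for $x$ close to $0$; (3) $a:=\lim_{x\to\infty}r(x)<\infty$; (4) $\lim_{x\to\infty}(a-r(x))x$ exists and is a finite real number; (5) $\lim_{x\to\infty}r'(x)=0$. Viscosity solutions. Let $H(x,p)=\sup_{u>0}\{(u-bx+r(x))p+\ln u-cx^2\}$, which equals $(r(x)-bx)p-\ln(-p)-1-cx^2$ for $p<0$ and $+\infty$ for $p\ge0$; equation $(\ast)$ is $\rho V-H(x,V_x)-\frac12\sigma^2x^2V_{xx}=0$. A continuous function $w$ is a viscosity subsolution of $(\ast)$ in $[0,\infty)$ if $\rho w(x)-H(x,\phi'(x))-\frac12\sigma^2x^2\phi''(x)\le0$ whenever $\phi$ is smooth and $w-\phi$ has a local maximum relative to $[0,\infty)$ at $x\in[0,\infty)$; it is a viscosity supersolution in $(0,\infty)$ if the reverse inequality holds whenever $\phi$ is smooth and $w-\phi$ has a local minimum at $x\in(0,\infty)$. "$Du\le-\frac1{c_1}$ in the viscosity sense" means $\phi'(x)\le-\frac1{c_1}$ whenever $\phi$ is smooth and $u-\phi$ has a local maximum at $x\in(0,\infty)$. *)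

theory Defs
  imports "HOL-Analysis.Analysis"
begin

text \<open>
  Functions on \<open>[0,\<infinity>)\<close> are total functions on the reals of which only the values on
  \<open>{0..}\<close> are used; in particular derivatives at \<open>0\<close> are one-sided.
\<close>

definition recycling_rate :: "real \<Rightarrow> real \<Rightarrow> (real \<Rightarrow> real) \<Rightarrow> bool" where
  "recycling_rate b \<rho> r \<longleftrightarrow>
     (\<exists>r'. (\<forall>x\<ge>0. (r has_real_derivative r' x) (at x within {0..})) \<and>
           continuous_on {0..} r' \<and> (r' \<longlongrightarrow> 0) at_top) \<and>
     mono_on {0..} r \<and>
     r 0 = 0 \<and> (\<exists>\<delta>>0. \<forall>x\<in>{0..<\<delta>}. r x \<le> (b + \<rho>) * x) \<and>
     (\<exists>a. (r \<longlongrightarrow> a) at_top \<and> (\<exists>l. ((\<lambda>x. (a - r x) * x) \<longlongrightarrow> l) at_top))"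

definition hamiltonian :: "real \<Rightarrow> real \<Rightarrow> (real \<Rightarrow> real) \<Rightarrow> real \<Rightarrow> real \<Rightarrow> ereal" where
  "hamiltonian b c r x p =
     (SUP \<alpha>\<in>{0<..}. ereal ((\<alpha> - b * x + r x) * p + ln \<alpha> - c * x\<^sup>2))"

lemma hamiltonian_neg:
  assumes "p < 0"
  shows "hamiltonian b c r x p = ereal ((r x - b * x) * p - ln (- p) - 1 - c * x\<^sup>2)"
proof (rule antisym)
  show "hamiltonian b c r x p \<le> ereal ((r x - b * x) * p - ln (- p) - 1 - c * x\<^sup>2)"
    unfolding hamiltonian_def
  proof (rule SUP_least)
    fix y :: real assume "y \<in> {0<..}"
    then have "y > 0" by simp
    with assms have "ln (y * (- p)) \<le> y * (- p) - 1"
      by (intro ln_le_minus_one) (simp add: mult_pos_neg)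
    moreover have "ln (y * (- p)) = ln y + ln (- p)"
      using assms \<open>y > 0\<close> by (intro ln_mult_pos) auto
    ultimately show "ereal ((y - b * x + r x) * p + ln y - c * x\<^sup>2)
        \<le> ereal ((r x - b * x) * p - ln (- p) - 1 - c * x\<^sup>2)"
      by (simp add: algebra_simps)
  qed
  have "(- 1 / p - b * x + r x) * p + ln (- 1 / p) - c * x\<^sup>2
      = (r x - b * x) * p - ln (- p) - 1 - c * x\<^sup>2"
  proof -
    have "ln (- 1 / p) = - ln (- p)"
      using assms ln_inverse[of "- p"] by (simp add: inverse_eq_divide)
    moreover have "- 1 / p * p = - 1" using assms by simp
    ultimately show ?thesis by (simp add: algebra_simps)
  qed
  moreover have "- 1 / p \<in> {0<..}"
    using assms by (simp add: divide_neg_neg)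
  ultimately show "ereal ((r x - b * x) * p - ln (- p) - 1 - c * x\<^sup>2) \<le> hamiltonian b c r x p"
    unfolding hamiltonian_def by (intro SUP_upper2[of "- 1 / p"]) auto
qed

lemma hamiltonian_nonneg:
  assumes "p \<ge> 0"
  shows "hamiltonian b c r x p = \<infinity>"
  unfolding hamiltonian_def
proof (rule SUP_PInfty)
  fix n :: nat
  define y where "y = exp (real n + \<bar>(r x - b * x) * p - c * x\<^sup>2\<bar>)"
  have "y > 0" by (simp add: y_def)
  then have "y * p \<ge> 0" using assms by simp
  moreover have "ln y = real n + \<bar>(r x - b * x) * p - c * x\<^sup>2\<bar>" by (simp add: y_def)
  ultimately have "real n \<le> y * p + ((r x - b * x) * p - c * x\<^sup>2) + ln y" by linarith
  then have "real n \<le> (y - b * x + r x) * p + ln y - c * x\<^sup>2" by (simp add: algebra_simps)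
  with \<open>y > 0\<close> show "\<exists>y\<in>{0<..}. ereal (real n) \<le> ereal ((y - b * x + r x) * p + ln y - c * x\<^sup>2)"
    by auto
qed

text \<open>
  Test functions are \<open>C\<^sup>\<infinity>\<close> on the whole line; by extension and cut-off this loses none
  of the test functions that are smooth only on \<open>[0,\<infinity>)\<close> or only near the point.
\<close>

definition smooth :: "(real \<Rightarrow> real) \<Rightarrow> bool" where
  "smooth \<phi> \<longleftrightarrow> (\<forall>n. (deriv ^^ n) \<phi> differentiable_on UNIV)"

definition local_max_in :: "real set \<Rightarrow> (real \<Rightarrow> real) \<Rightarrow> real \<Rightarrow> bool" where
  "local_max_in S f x \<longleftrightarrow> (\<forall>\<^sub>F y in at x within S. f y \<le> f x)"

definition local_min_in :: "real set \<Rightarrow> (real \<Rightarrow> real) \<Rightarrow> real \<Rightarrow> bool" where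
  "local_min_in S f x \<longleftrightarrow> (\<forall>\<^sub>F y in at x within S. f x \<le> f y)"

text \<open>
  The residual of the equation at \<open>x\<close> for a value \<open>w x\<close> and a test function \<open>\<phi>\<close>. It is \<open>-\<infinity>\<close>
  exactly if \<open>\<phi>' x \<ge> 0\<close>, since the Hamiltonian is never \<open>-\<infinity>\<close>.
\<close>

definition residual ::
  "real \<Rightarrow> real \<Rightarrow> real \<Rightarrow> real \<Rightarrow> (real \<Rightarrow> real) \<Rightarrow> (real \<Rightarrow> real) \<Rightarrow> (real \<Rightarrow> real) \<Rightarrow> real \<Rightarrow> ereal"
where
  "residual b c \<rho> \<sigma> r w \<phi> x =
     ereal (\<rho> * w x) - hamiltonian b c r x (deriv \<phi> x)
       - ereal (1 / 2 * \<sigma>\<^sup>2 * x\<^sup>2 * deriv (deriv \<phi>) x)"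

definition viscosity_subsolution ::
  "real \<Rightarrow> real \<Rightarrow> real \<Rightarrow> real \<Rightarrow> (real \<Rightarrow> real) \<Rightarrow> real set \<Rightarrow> (real \<Rightarrow> real) \<Rightarrow> bool" where
  "viscosity_subsolution b c \<rho> \<sigma> r S w \<longleftrightarrow> continuous_on S w \<and>
     (\<forall>\<phi> x. smooth \<phi> \<longrightarrow> x \<in> S \<longrightarrow> local_max_in S (\<lambda>y. w y - \<phi> y) x \<longrightarrow>
        residual b c \<rho> \<sigma> r w \<phi> x \<le> 0)"

definition viscosity_supersolution ::
  "real \<Rightarrow> real \<Rightarrow> real \<Rightarrow> real \<Rightarrow> (real \<Rightarrow> real) \<Rightarrow> real set \<Rightarrow> (real \<Rightarrow> real) \<Rightarrow> bool" where
  "viscosity_supersolution b c \<rho> \<sigma> r S w \<longleftrightarrow> continuous_on S w \<and>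
     (\<forall>\<phi> x. smooth \<phi> \<longrightarrow> x \<in> S \<longrightarrow> local_min_in S (\<lambda>y. w y - \<phi> y) x \<longrightarrow>
        0 \<le> residual b c \<rho> \<sigma> r w \<phi> x)"

definition viscosity_deriv_le :: "real set \<Rightarrow> (real \<Rightarrow> real) \<Rightarrow> real \<Rightarrow> bool" where
  "viscosity_deriv_le S w m \<longleftrightarrow>
     (\<forall>\<phi> x. smooth \<phi> \<longrightarrow> x \<in> S \<longrightarrow> local_max_in S (\<lambda>y. w y - \<phi> y) x \<longrightarrow> deriv \<phi> x \<le> m)"

definition critical_exponent :: "real \<Rightarrow> real \<Rightarrow> real \<Rightarrow> ereal" where
  "critical_exponent b \<rho> \<sigma> =
     (if \<sigma> = 0 then \<infinity>
      else ereal (THE k. k < 0 \<and> k\<^sup>2 + (1 + 2 * b / \<sigma>\<^sup>2) * k - 2 * \<rho> / \<sigma>\<^sup>2 = 0))"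

lemma negative_root_unique:
  fixes A B :: real
  assumes "B > 0"
  shows "\<exists>!k. k < 0 \<and> k\<^sup>2 + A * k - B = 0"
proof -
  define s where "s = sqrt (A\<^sup>2 + 4 * B)"
  have s2: "s\<^sup>2 = A\<^sup>2 + 4 * B" using assms by (simp add: s_def)
  have s: "s > \<bar>A\<bar>" unfolding s_def using assms by (intro real_less_rsqrt) simp
  have "k\<^sup>2 + A * k - B = (k - (- A - s) / 2) * (k - (- A + s) / 2)" for k
    using s2 by (simp add: power2_eq_square field_simps)
  then have "k < 0 \<and> k\<^sup>2 + A * k - B = 0 \<longleftrightarrow> k = (- A - s) / 2" for k
    using s by auto
  then show ?thesis by metis
qed

end

theory Submission
  imports Defs
begin

text \<open>
  Comparison rests on the penalty \<open>\<psi> x = \<epsilon> * (A + x powr m)\<close> with \<open>max q 1 < m < \<bar>k(\<sigma>)\<bar>\<close>.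
  Below the critical exponent the linear operator \<open>\<rho> w + b x w' - \<sigma>\<^sup>2 / 2 * x\<^sup>2 w''\<close> is a positive
  multiple of \<open>x powr m\<close> on \<open>x powr m\<close>, so for large \<open>A\<close> it stays positive on \<open>\<psi>\<close> even after
  subtracting \<open>(r + c1) \<psi>'\<close> (\<open>power_barrier_strict\<close>). As \<open>m > q\<close>, the function \<open>u - v - \<psi>\<close> attains
  its maximum, and if \<open>u \<le> v\<close> fails somewhere, this maximum is positive for small \<open>\<epsilon>\<close>.

  Suppose that the maximum is at some \<open>x0 > 0\<close>. Then \<open>u - v\<close> is touched from above by \<open>\<psi>\<close>, and the
  claim \<open>difference_jet\<close> is that \<open>u - v\<close> is a viscosity subsolution of the linear equation above
  with drift \<open>b x - r\<close> and the additional term \<open>- c1 * max (w') 0\<close>. The last term comes from the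
  logarithm: since \<open>u' \<le> - 1 / c1\<close>, lowering the slope by \<open>p \<ge> 0\<close> raises \<open>ln (- u')\<close> by at
  most \<open>c1 * p\<close>. This contradicts the choice of \<open>A\<close>.

  For \<open>\<sigma> = 0\<close> the claim follows by doubling the variable. For \<open>\<sigma> \<noteq> 0\<close> the equation is uniformly
  elliptic near \<open>x0\<close>, and in one dimension no almost-everywhere differentiability is needed. The
  equation bounds the second-order part of every jet from below by \<open>- C * (1 + \<bar>slope\<bar>)\<close> for \<open>u\<close>
  and for \<open>- v\<close>; a parabolic barrier makes both Lipschitz, and then semiconvex near \<open>x0\<close>
  (\<open>semiconvex_near\<close>). Two semiconvex functions whose sum is touched from above by a parabola are
  both differentiable at \<open>x0\<close>, and slopes of nearby jets converge to the derivatives there. Hence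
  the equation gives curvature bounds near \<open>x0\<close> which are as sharp as the equation at \<open>x0\<close>. If
  the claim failed, \<open>u - v\<close> minus the touching parabola would be strictly convex near its maximum
  (\<open>superjet_curvature_sum\<close>).

  Suppose that the maximum is at \<open>0\<close>. There the equation reads \<open>\<rho> w + ln (- w') + 1 = 0\<close>. For the
  supersolution the test functions \<open>p x + \<kappa> ln x\<close> show that \<open>\<rho> v 0 + ln (- p) + 1 < 0\<close> forces
  \<open>v x \<le> v 0 + p x\<close> near \<open>0\<close>. As \<open>\<psi>\<close> is flat at \<open>0\<close>, \<open>u\<close> lies below a line of almost the same
  slope, and the subsolution property at the origin gives \<open>u 0 \<le> v 0\<close> (\<open>no_origin_max\<close>).
\<close>

section \<open>Parabolic jets\<close>

text \<open>
  The jet \<open>(p, X)\<close> of a parabola touching \<open>w\<close> from above at \<open>x\<close>. Parabolas are rich enough as test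
  functions: a \<open>C\<^sup>2\<close> function touching from above gives the jets with slightly larger \<open>X\<close>. Subjets
  of \<open>w\<close> are expressed as superjets of \<open>- w\<close>.
\<close>

definition superjet :: "(real \<Rightarrow> real) \<Rightarrow> real \<Rightarrow> real \<Rightarrow> real \<Rightarrow> bool" where
  "superjet w x p X \<longleftrightarrow> (\<forall>\<^sub>F y in at x. w y \<le> w x + p * (y - x) + X / 2 * (y - x)\<^sup>2)"

definition parabola :: "real \<Rightarrow> real \<Rightarrow> real \<Rightarrow> real \<Rightarrow> real" where
  "parabola x p X y = p * (y - x) + X / 2 * (y - x)\<^sup>2"

lemma parabola_has_derivative:
  "(parabola x p X has_real_derivative p + X * (y - x)) (at y)"
  unfolding parabola_def[abs_def]
  by (auto intro!: derivative_eq_intros simp: power2_eq_square field_simps)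

lemma deriv_parabola: "deriv (parabola x p X) = (\<lambda>y. p + X * (y - x))"
  using parabola_has_derivative DERIV_imp_deriv by blast

lemma deriv_deriv_parabola: "deriv (deriv (parabola x p X)) = (\<lambda>_. X)"
  unfolding deriv_parabola
  by (rule ext, rule DERIV_imp_deriv) (auto intro!: derivative_eq_intros)

lemma smooth_parabola: "smooth (parabola x p X)"
proof -
  have "\<exists>a b d. (deriv ^^ n) (parabola x p X) = (\<lambda>y. a + b * y + d * y\<^sup>2)" for n
  proof (induction n)
    case 0
    have "parabola x p X = (\<lambda>y. (X / 2 * x\<^sup>2 - p * x) + (p - X * x) * y + X / 2 * y\<^sup>2)"
      by (auto simp: parabola_def fun_eq_iff power2_eq_square field_simps)
    then show ?case by (metis funpow_0)
  next
    case (Suc n)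
    then obtain a b d where eq: "(deriv ^^ n) (parabola x p X) = (\<lambda>y. a + b * y + d * y\<^sup>2)"
      by blast
    have "deriv (\<lambda>y. a + b * y + d * y\<^sup>2) = (\<lambda>y::real. b + 2 * d * y + 0 * y\<^sup>2)"
      by (rule ext, rule DERIV_imp_deriv) (auto intro!: derivative_eq_intros)
    then have "(deriv ^^ Suc n) (parabola x p X) = (\<lambda>y. b + 2 * d * y + 0 * y\<^sup>2)"
      using eq by simp
    then show ?case by blast
  qed
  moreover have "(\<lambda>y::real. a + b * y + d * y\<^sup>2) differentiable_on UNIV" for a b d
    unfolding differentiable_on_def by (auto intro!: derivative_intros)
  ultimately have "(deriv ^^ n) (parabola x p X) differentiable_on UNIV" for n
    by metis
  then show ?thesis by (simp add: smooth_def)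
qed

lemma superjet_local_max:
  assumes "superjet w x p X"
  shows "local_max_in S (\<lambda>y. w y - parabola x p X y) x"
  using assms filter_leD[OF at_le[OF subset_UNIV]]
  unfolding local_max_in_def superjet_def parabola_def
  by (fastforce elim: eventually_mono simp: algebra_simps)

lemma superjet_uminus_local_min:
  assumes "superjet (\<lambda>y. - w y) x (- p) (- X)"
  shows "local_min_in S (\<lambda>y. w y - parabola x p X y) x"
  using superjet_local_max[OF assms, of S]
  unfolding local_max_in_def local_min_in_def parabola_def
  by (auto elim!: eventually_mono simp: algebra_simps)

lemma superjet_touch:
  assumes "\<forall>\<^sub>F y in at x. w y - \<phi> y \<le> w x - \<phi> x" and "superjet \<phi> x p X"
  shows "superjet w x p X"
  using assms unfolding superjet_def
  by (rule eventually_elim2) simp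

lemma superjet_add_parabola:
  "superjet (\<lambda>y. w y + m / 2 * y\<^sup>2) x p X \<longleftrightarrow> superjet w x (p - m * x) (X - m)"
proof -
  have "w y + m / 2 * y\<^sup>2 \<le> w x + m / 2 * x\<^sup>2 + p * (y - x) + X / 2 * (y - x)\<^sup>2 \<longleftrightarrow>
     w y \<le> w x + (p - m * x) * (y - x) + (X - m) / 2 * (y - x)\<^sup>2" for y
  proof -
    have "m / 2 * x\<^sup>2 + p * (y - x) + X / 2 * (y - x)\<^sup>2 - m / 2 * y\<^sup>2
        = (p - m * x) * (y - x) + (X - m) / 2 * (y - x)\<^sup>2"
      by (simp add: power2_eq_square field_simps)
    then show ?thesis by linarith
  qed
  then show ?thesis unfolding superjet_def by simp
qed

text \<open>
  Reflection turns an estimate to the right of a point into one to the left of it.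
\<close>

lemma superjet_reflect:
  "superjet (\<lambda>y. w (- y)) x p X \<longleftrightarrow> superjet w (- x) (- p) X"
proof -
  have half: "\<forall>\<^sub>F y in at (- x). P (- y)" if "eventually P (at x)" for P and x :: real
  proof -
    obtain d where d: "d > 0" "\<And>y. y \<noteq> x \<Longrightarrow> dist y x < d \<Longrightarrow> P y"
      using \<open>eventually P (at x)\<close> unfolding eventually_at by blast
    have "P (- y)" if "y \<noteq> - x" "dist y (- x) < d" for y
      using d(2)[of "- y"] that by (simp add: dist_real_def abs_minus_commute add.commute minus_equation_iff)
    then show ?thesis using d(1) by (auto simp: eventually_at)
  qed
  have "(\<forall>\<^sub>F y in at (- x). P y) \<longleftrightarrow> (\<forall>\<^sub>F y in at x. P (- y))" for P and x :: real
    using half[of P "- x"] half[of "\<lambda>y. P (- y)" x] by force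
  then show ?thesis by (simp add: superjet_def algebra_simps power2_commute)
qed

text \<open>
  By the second-order Taylor expansion; this supplies jets of test functions that are only smooth
  near the point.
\<close>

lemma superjet_of_second_derivative:
  fixes \<phi> \<phi>' :: "real \<Rightarrow> real"
  assumes d1: "\<forall>\<^sub>F y in nhds x. (\<phi> has_real_derivative \<phi>' y) (at y)"
    and d2: "(\<phi>' has_real_derivative D) (at x)" and "D < X"
  shows "superjet \<phi> x (\<phi>' x) X"
proof -
  have "\<forall>\<^sub>F y in at x. (\<phi>' y - \<phi>' x) / (y - x) < X"
    using d2 \<open>D < X\<close> by (auto simp: has_field_derivative_iff intro: order_tendstoD(2))
  then obtain d2 where d2: "d2 > 0"
    "\<And>y. y \<noteq> x \<Longrightarrow> dist y x < d2 \<Longrightarrow> (\<phi>' y - \<phi>' x) / (y - x) < X"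
    by (auto simp: eventually_at)
  from d1 obtain d1 where d1: "d1 > 0"
    "\<And>y. dist y x < d1 \<Longrightarrow> (\<phi> has_real_derivative \<phi>' y) (at y)"
    by (auto simp: eventually_nhds_metric)
  define g where "g y = \<phi> y - parabola x (\<phi>' x) X y" for y
  have g': "(g has_real_derivative \<phi>' y - \<phi>' x - X * (y - x)) (at y)" if "dist y x < d1" for y
    unfolding g_def using DERIV_diff[OF d1(2)[OF that] parabola_has_derivative[of x "\<phi>' x" X y]]
    by (simp add: algebra_simps)
  have le: "g y \<le> g x" if y: "dist y x < min d1 d2" "y \<noteq> x" for y
  proof (cases "x < y")
    case True
    obtain z where z: "x < z" "z < y" "g y - g x = (y - x) * (\<phi>' z - \<phi>' x - X * (z - x))"
      using MVT2[OF True, of g "\<lambda>z. \<phi>' z - \<phi>' x - X * (z - x)"] g' y True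
      by (auto simp: dist_real_def)
    have "(\<phi>' z - \<phi>' x) / (z - x) < X" using d2(2)[of z] z y by (auto simp: dist_real_def)
    then have "\<phi>' z - \<phi>' x - X * (z - x) < 0" using z by (simp add: field_simps)
    then have "g y - g x \<le> 0" using z(3) True by (simp add: mult_nonneg_nonpos)
    then show ?thesis by simp
  next
    case False
    then have yx: "y < x" using y by simp
    obtain z where z: "y < z" "z < x" "g x - g y = (x - y) * (\<phi>' z - \<phi>' x - X * (z - x))"
      using MVT2[OF yx, of g "\<lambda>z. \<phi>' z - \<phi>' x - X * (z - x)"] g' y yx
      by (auto simp: dist_real_def)
    have "(\<phi>' z - \<phi>' x) / (z - x) < X" using d2(2)[of z] z y by (auto simp: dist_real_def)
    then have "\<phi>' z - \<phi>' x - X * (z - x) > 0" using z by (simp add: field_simps)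
    then have "g x - g y \<ge> 0" using z(3) yx by simp
    then show ?thesis by simp
  qed
  have "\<forall>\<^sub>F y in at x. g y \<le> g x"
    unfolding eventually_at using le d1(1) d2(1)
    by (intro exI[of _ "min d1 d2"]) auto
  then show ?thesis
    unfolding superjet_def g_def parabola_def by (auto elim!: eventually_mono)
qed

section \<open>The equation in terms of jets\<close>

definition first_order_part ::
  "real \<Rightarrow> real \<Rightarrow> real \<Rightarrow> (real \<Rightarrow> real) \<Rightarrow> real \<Rightarrow> real \<Rightarrow> real \<Rightarrow> real" where
  "first_order_part b c \<rho> r x z p = \<rho> * z + (b * x - r x) * p + ln (- p) + c * x\<^sup>2 + 1"

lemma residual_parabola:
  assumes "p < 0"
  shows "residual b c \<rho> \<sigma> r w (parabola x p X) x =
    ereal (first_order_part b c \<rho> r x (w x) p - \<sigma>\<^sup>2 / 2 * x\<^sup>2 * X)"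
  using assms
  by (simp add: residual_def deriv_parabola[unfolded fun_eq_iff] deriv_deriv_parabola
      hamiltonian_neg first_order_part_def algebra_simps)

lemma subsolution_superjet:
  assumes "viscosity_subsolution b c \<rho> \<sigma> r {0..} u" "viscosity_deriv_le {0<..} u (- (1 / c1))"
    and "c1 > 0" "x > 0" "superjet u x p X"
  shows "p \<le> - (1 / c1)" "first_order_part b c \<rho> r x (u x) p \<le> \<sigma>\<^sup>2 / 2 * x\<^sup>2 * X"
proof -
  have "deriv (parabola x p X) x \<le> - (1 / c1)"
    using assms(2,4) superjet_local_max[OF assms(5)] smooth_parabola
    by (auto simp: viscosity_deriv_le_def)
  then show p: "p \<le> - (1 / c1)" by (simp add: deriv_parabola)
  have "residual b c \<rho> \<sigma> r u (parabola x p X) x \<le> 0"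
    using assms(1,4) superjet_local_max[OF assms(5)] smooth_parabola
    by (auto simp: viscosity_subsolution_def)
  moreover have "p < 0" using p \<open>c1 > 0\<close> using zero_less_divide_1_iff[of c1] by linarith
  ultimately show "first_order_part b c \<rho> r x (u x) p \<le> \<sigma>\<^sup>2 / 2 * x\<^sup>2 * X"
    by (simp add: residual_parabola)
qed

text \<open>
  The slope is negative because the Hamiltonian is infinite for nonnegative slopes.
\<close>

lemma supersolution_subjet:
  assumes "viscosity_supersolution b c \<rho> \<sigma> r {0<..} v"
    and "x > 0" "superjet (\<lambda>y. - v y) x (- p) (- X)"
  shows "p < 0" "\<sigma>\<^sup>2 / 2 * x\<^sup>2 * X \<le> first_order_part b c \<rho> r x (v x) p"
proof -
  have *: "0 \<le> residual b c \<rho> \<sigma> r v (parabola x p X) x"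
    using assms(1,2) superjet_uminus_local_min[OF assms(3)] smooth_parabola
    by (auto simp: viscosity_supersolution_def)
  show "p < 0"
  proof (rule ccontr)
    assume "\<not> p < 0"
    then show False
      using * hamiltonian_nonneg[of p b c r x] by (simp add: residual_def deriv_parabola)
  qed
  then show "\<sigma>\<^sup>2 / 2 * x\<^sup>2 * X \<le> first_order_part b c \<rho> r x (v x) p"
    using * by (simp add: residual_parabola)
qed

text \<open>
  The diffusion and the drift vanish at \<open>0\<close>, and a line that touches from the right suffices.
\<close>

lemma subsolution_at_origin:
  assumes "viscosity_subsolution b c \<rho> \<sigma> r {0..} u" "p < 0" "r 0 = 0"
    and "\<forall>\<^sub>F y in at_right 0. u y \<le> u 0 + p * y"
  shows "\<rho> * u 0 + ln (- p) + 1 \<le> 0"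
proof -
  have "at (0::real) within {0..} = at_right 0"
    by (rule at_within_Ici_at_right)
  then have "local_max_in {0..} (\<lambda>y. u y - parabola 0 p 0 y) 0"
    using assms(4) by (auto simp: local_max_in_def parabola_def elim!: eventually_mono)
  then have "residual b c \<rho> \<sigma> r u (parabola 0 p 0) 0 \<le> 0"
    using assms(1) smooth_parabola by (auto simp: viscosity_subsolution_def)
  then show ?thesis using assms(2,3)
    by (simp add: residual_parabola first_order_part_def)
qed

section \<open>Curvature bounds, Lipschitz bounds and semiconvexity\<close>

text \<open>
  If \<open>w + M / 2 * x\<^sup>2\<close> exceeded a chord, it would still do so after adding a slightly convex parabola
  that vanishes at the ends of the chord. The maximum of the excess would then give a jet with
  second-order part below \<open>- M\<close>.
\<close>

lemma convex_on_of_superjets: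
  fixes w :: "real \<Rightarrow> real"
  assumes cont: "continuous_on {\<alpha>..\<beta>} w"
    and jets: "\<And>x p X. \<alpha> < x \<Longrightarrow> x < \<beta> \<Longrightarrow> superjet w x p X \<Longrightarrow> - M \<le> X"
  shows "convex_on {\<alpha>..\<beta>} (\<lambda>x. w x + M / 2 * x\<^sup>2)"
proof (rule convex_on_linorderI)
  fix t x y :: real
  assume t: "t > 0" "t < 1" and xy: "x \<in> {\<alpha>..\<beta>}" "y \<in> {\<alpha>..\<beta>}" "x < y"
  define f where "f z = w z + M / 2 * z\<^sup>2" for z
  define s where "s = (f y - f x) / (y - x)"
  define z where "z = (1 - t) * x + t * y"
  have zx: "z - x = t * (y - x)" "y - z = (1 - t) * (y - x)"
    by (simp_all add: z_def algebra_simps)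
  have "0 < z - x" "0 < y - z" unfolding zx using t xy by auto
  then have z: "x < z" "z < y" by linarith+
  have fy: "f y = f x + s * (y - x)" using xy by (simp add: s_def)
  have chord: "(1 - t) * f x + t * f y = f x + s * (z - x)"
    unfolding fy zx by (simp add: algebra_simps)
  have "f z \<le> f x + s * (z - x)"
  proof (rule ccontr)
    assume "\<not> ?thesis"
    then have gap: "f z - (f x + s * (z - x)) > 0" by simp
    \<comment> \<open>half of what would bring the excess at z down to 0\<close>
    define e where "e = (f z - (f x + s * (z - x))) / (2 * ((z - x) * (y - z)))"
    have e: "e > 0" using gap z by (simp add: e_def)
    define g where "g \<tau> = f \<tau> - (f x + s * (\<tau> - x)) - e * ((\<tau> - x) * (y - \<tau>))" for \<tau>
    have gx: "g x = 0" "g y = 0" by (auto simp: g_def fy)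
    have "e * ((z - x) * (y - z)) = (f z - (f x + s * (z - x))) / 2"
      using z by (simp add: e_def)
    then have gz: "g z > 0" using gap by (simp add: g_def)
    have "continuous_on {x..y} g"
      unfolding g_def f_def using xy
      by (auto intro!: continuous_intros continuous_on_subset[OF cont])
    then obtain \<xi> where \<xi>: "\<xi> \<in> {x..y}" "\<And>\<tau>. \<tau> \<in> {x..y} \<Longrightarrow> g \<tau> \<le> g \<xi>"
      using continuous_attains_sup[of "{x..y}" g] xy by auto
    have "g \<xi> > 0" using \<xi>(2)[of z] gz z by force
    then have in_xy: "x < \<xi>" "\<xi> < y" using \<xi>(1) gx by (metis atLeastAtMost_iff less_le less_irrefl)+
    have near: "\<forall>\<^sub>F \<tau> in at \<xi>. \<tau> \<in> {x<..<y}"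
      using in_xy by (intro eventually_at_in_open') auto
    have "superjet f \<xi> (s + e * (y - \<xi>) - e * (\<xi> - x)) (- 2 * e)"
      unfolding superjet_def
    proof (rule eventually_mono[OF near])
      fix \<tau> assume "\<tau> \<in> {x<..<y}"
      then have "g \<tau> \<le> g \<xi>" using \<xi>(2)[of \<tau>] by auto
      then show "f \<tau> \<le> f \<xi> + (s + e * (y - \<xi>) - e * (\<xi> - x)) * (\<tau> - \<xi>) + - 2 * e / 2 * (\<tau> - \<xi>)\<^sup>2"
        by (simp add: g_def power2_eq_square algebra_simps)
    qed
    then obtain p where "superjet w \<xi> p (- 2 * e - M)"
      unfolding f_def superjet_add_parabola by blast
    then have "- M \<le> - 2 * e - M" using jets[of \<xi>] in_xy xy by auto
    then show False using e by simp
  qed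
  then show "w ((1 - t) *\<^sub>R x + t *\<^sub>R y) + M / 2 * ((1 - t) *\<^sub>R x + t *\<^sub>R y)\<^sup>2
    \<le> (1 - t) * (w x + M / 2 * x\<^sup>2) + t * (w y + M / 2 * y\<^sup>2)"
    using chord unfolding f_def z_def by simp
qed auto

text \<open>
  The barrier at \<open>y\<close> is \<open>B * (h - C * h\<^sup>2)\<close> with \<open>h = y - \<tau>\<close> the distance to \<open>y\<close>. On an interval of
  length at most \<open>1 / (2 C)\<close> it is nonnegative with slope at most \<open>B\<close> in absolute value, so its
  second derivative \<open>- 2 B C\<close> violates the curvature bound as soon as \<open>B > 1\<close>, and \<open>w\<close> cannot touch
  it from below. The second condition on \<open>B\<close> puts the barrier above \<open>w\<close> at the left end.
\<close>

lemma lipschitz_barrier: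
  fixes w :: "real \<Rightarrow> real"
  assumes cont: "continuous_on {\<alpha>..\<beta>} w"
    and jets: "\<And>x p X. \<alpha> < x \<Longrightarrow> x < \<beta> \<Longrightarrow> superjet w x p X \<Longrightarrow> - (C * (1 + \<bar>p\<bar>)) \<le> X"
    and C: "C > 0" "2 * C * (\<beta> - \<alpha>) \<le> 1"
    and osc: "\<And>x y. x \<in> {\<alpha>..\<beta>} \<Longrightarrow> y \<in> {\<alpha>..\<beta>} \<Longrightarrow> w x - w y \<le> W"
    and xy: "\<alpha> < \<alpha>'" "\<alpha>' \<le> x" "x < y" "y \<le> \<beta>"
    and B: "B > 1" "2 * W / (\<alpha>' - \<alpha>) \<le> B"
  shows "w x - w y \<le> B * (y - x)"
proof -
  define h where "h \<tau> = B * ((y - \<tau>) - C * (y - \<tau>)\<^sup>2)" for \<tau>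
  define g where "g \<tau> = w \<tau> - h \<tau>" for \<tau>
  have gy: "g y = w y" by (simp add: g_def h_def)
  have len: "C * (y - \<tau>) \<le> 1 / 2" if "\<alpha> \<le> \<tau>" for \<tau>
  proof -
    have "C * (y - \<tau>) \<le> C * (\<beta> - \<alpha>)" using that xy C by (intro mult_left_mono) auto
    moreover have "2 * C * (\<beta> - \<alpha>) = 2 * (C * (\<beta> - \<alpha>))" by simp
    ultimately show ?thesis using C(2) by linarith
  qed
  have ga: "g \<alpha> \<le> w y"
  proof -
    have "C * (y - \<alpha>) * (y - \<alpha>) \<le> 1 / 2 * (y - \<alpha>)"
      using len[of \<alpha>] xy by (intro mult_right_mono) auto
    then have "C * (y - \<alpha>)\<^sup>2 \<le> (y - \<alpha>) / 2" by (simp add: power2_eq_square mult.assoc)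
    moreover have "(\<alpha>' - \<alpha>) / 2 \<le> (y - \<alpha>) / 2" using xy by simp
    ultimately have "(\<alpha>' - \<alpha>) / 2 \<le> (y - \<alpha>) - C * (y - \<alpha>)\<^sup>2" by argo
    then have "B * ((\<alpha>' - \<alpha>) / 2) \<le> h \<alpha>"
      unfolding h_def using B by (intro mult_left_mono) auto
    moreover have "W \<le> B * ((\<alpha>' - \<alpha>) / 2)" using B xy by (simp add: field_simps)
    moreover have "w \<alpha> - w y \<le> W" using xy by (intro osc) auto
    ultimately show ?thesis by (simp add: g_def)
  qed
  have "continuous_on {\<alpha>..y} g"
    unfolding g_def h_def using xy
    by (auto intro!: continuous_intros continuous_on_subset[OF cont])
  then obtain \<xi> where \<xi>: "\<xi> \<in> {\<alpha>..y}" "\<And>\<tau>. \<tau> \<in> {\<alpha>..y} \<Longrightarrow> g \<tau> \<le> g \<xi>"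
    using continuous_attains_sup[of "{\<alpha>..y}" g] xy by auto
  have "g \<xi> \<le> w y"
  proof (rule ccontr)
    assume "\<not> g \<xi> \<le> w y"
    then have in_xy: "\<alpha> < \<xi>" "\<xi> < y" using \<xi>(1) ga gy
      by (metis atLeastAtMost_iff less_le order_refl)+
    have near: "\<forall>\<^sub>F \<tau> in at \<xi>. \<tau> \<in> {\<alpha><..<y}"
      using in_xy by (intro eventually_at_in_open') auto
    define p where "p = - B * (1 - 2 * C * (y - \<xi>))"
    have "superjet w \<xi> p (- 2 * B * C)"
      unfolding superjet_def
    proof (rule eventually_mono[OF near])
      fix \<tau> assume "\<tau> \<in> {\<alpha><..<y}"
      then have "g \<tau> \<le> g \<xi>" using \<xi>(2)[of \<tau>] by auto
      moreover have "h \<tau> - h \<xi> = p * (\<tau> - \<xi>) + - 2 * B * C / 2 * (\<tau> - \<xi>)\<^sup>2"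
        by (simp add: h_def p_def power2_eq_square algebra_simps)
      ultimately show "w \<tau> \<le> w \<xi> + p * (\<tau> - \<xi>) + - 2 * B * C / 2 * (\<tau> - \<xi>)\<^sup>2"
        by (simp add: g_def)
    qed
    then have X: "- (C * (1 + \<bar>p\<bar>)) \<le> - 2 * B * C"
      using jets[of \<xi> p "- 2 * B * C"] in_xy xy by simp
    have "\<bar>p\<bar> \<le> B"
    proof -
      have "0 \<le> 1 - 2 * C * (y - \<xi>)" "1 - 2 * C * (y - \<xi>) \<le> 1"
        using len[of \<xi>] in_xy C by auto
      then show ?thesis using B
        by (simp add: p_def abs_mult mult_left_le)
    qed
    then have "C * (1 + \<bar>p\<bar>) < C * (2 * B)" using B C by (intro mult_strict_left_mono) auto
    then show False using X by (simp add: mult.commute mult.left_commute)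
  qed
  then have "g x \<le> w y" using \<xi>(2)[of x] xy by force
  moreover have "h x \<le> B * (y - x)" using B C by (simp add: h_def algebra_simps)
  ultimately show ?thesis by (simp add: g_def)
qed

lemma superjet_slope_ge:
  assumes "superjet w x p X" "x < \<beta>" and "\<And>y. x < y \<Longrightarrow> y < \<beta> \<Longrightarrow> - L * (y - x) \<le> w y - w x"
  shows "- L \<le> p"
proof -
  have "\<forall>\<^sub>F y in at_right x. y \<in> {x<..<\<beta>}" using assms(2) by (rule eventually_at_right_real)
  moreover have "\<forall>\<^sub>F y in at_right x. w y \<le> w x + p * (y - x) + X / 2 * (y - x)\<^sup>2"
    using assms(1) unfolding superjet_def by (rule filter_leD[OF at_le[OF subset_UNIV]])
  ultimately have "\<forall>\<^sub>F y in at_right x. - L \<le> p + X / 2 * (y - x)"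
  proof eventually_elim
    case (elim y)
    then have "- L * (y - x) \<le> w y - w x" using assms(3)[of y] by auto
    moreover have "p * (y - x) + X / 2 * (y - x)\<^sup>2 = (p + X / 2 * (y - x)) * (y - x)"
      by (simp add: power2_eq_square field_simps)
    ultimately have "- L * (y - x) \<le> (p + X / 2 * (y - x)) * (y - x)"
      using elim by linarith
    then show ?case using elim mult_le_cancel_right_pos[of "y - x" "- L"] by simp
  qed
  moreover have "((\<lambda>y. p + X / 2 * (y - x)) \<longlongrightarrow> p + X / 2 * (x - x)) (at_right x)"
    by (intro tendsto_intros)
  ultimately show ?thesis
    using tendsto_lowerbound[of _ "p + X / 2 * (x - x)" "at_right x" "- L"] by simp
qed

text \<open>
  The Lipschitz bound, from both sides, bounds the slopes of jets. The curvature bound is then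
  uniform.
\<close>

lemma semiconvex_near:
  fixes w :: "real \<Rightarrow> real"
  assumes cont: "continuous_on {\<alpha>..\<beta>} w" and x0: "\<alpha> < x0" "x0 < \<beta>"
    and jets: "\<And>x p X. \<alpha> < x \<Longrightarrow> x < \<beta> \<Longrightarrow> superjet w x p X \<Longrightarrow> - (C * (1 + \<bar>p\<bar>)) \<le> X"
    and C: "C > 0"
  shows "\<exists>M \<delta>. 0 < \<delta> \<and> convex_on {x0 - \<delta>..x0 + \<delta>} (\<lambda>x. w x + M / 2 * x\<^sup>2)"
proof -
  define d where "d = min (min (x0 - \<alpha>) (\<beta> - x0)) (1 / (4 * C))"
  have d: "d > 0" "x0 - d \<ge> \<alpha>" "x0 + d \<le> \<beta>" using x0 C by (auto simp: d_def)
  have "d \<le> 1 / (4 * C)" by (simp add: d_def)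
  then have dC: "2 * C * ((x0 + d) - (x0 - d)) \<le> 1" using C by (simp add: field_simps)
  have cont': "continuous_on {x0 - d..x0 + d} w"
    by (rule continuous_on_subset[OF cont]) (use d in auto)
  then have "bounded (w ` {x0 - d..x0 + d})"
    by (intro compact_imp_bounded compact_continuous_image) auto
  then obtain N where N: "\<And>x. x \<in> {x0 - d..x0 + d} \<Longrightarrow> \<bar>w x\<bar> \<le> N"
    unfolding bounded_iff by (metis imageI real_norm_def)
  have osc: "w x - w y \<le> 2 * N" if "x \<in> {x0 - d..x0 + d}" "y \<in> {x0 - d..x0 + d}" for x y
    using N[OF that(1)] N[OF that(2)] by linarith
  define L where "L = max 2 (2 * (2 * N) / (d / 2))"
  have right: "w x - w y \<le> L * (y - x)" if "x0 - d / 2 \<le> x" "x < y" "y \<le> x0 + d" for x y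
    using d that dC C
    by (intro lipschitz_barrier[of "x0 - d" "x0 + d" w C "2 * N" "x0 - d / 2"] cont' jets osc)
      (auto simp: L_def)
  have left: "w y - w x \<le> L * (y - x)" if "x0 - d \<le> x" "x < y" "y \<le> x0 + d / 2" for x y
  proof -
    have "w (- (- y)) - w (- (- x)) \<le> L * (- x - - y)"
    proof (rule lipschitz_barrier[of "- x0 - d" "- x0 + d" "\<lambda>z. w (- z)" C "2 * N" "- x0 - d / 2"])
      show "continuous_on {- x0 - d..- x0 + d} (\<lambda>z. w (- z))"
        by (rule continuous_on_compose2[OF cont']) (auto intro!: continuous_intros)
      show "- (C * (1 + \<bar>p\<bar>)) \<le> X" if "- x0 - d < z" "z < - x0 + d" "superjet (\<lambda>z. w (- z)) z p X"
        for z p X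
        using jets[of "- z" "- p" X] that d unfolding superjet_reflect by auto
    qed (use that d dC C osc in \<open>auto simp: L_def\<close>)
    then show ?thesis by simp
  qed
  have slope: "\<bar>p\<bar> \<le> L" if x: "x0 - d / 2 < x" "x < x0 + d / 2" and jet: "superjet w x p X" for x p X
  proof -
    have "- L \<le> p"
      by (rule superjet_slope_ge[OF jet, of "x0 + d"]) (use right[of x] x d in \<open>auto simp: algebra_simps\<close>)
    moreover have "- L \<le> - p"
    proof (rule superjet_slope_ge[of "\<lambda>z. w (- z)" "- x" "- p" X "- x0 + d"])
      show "superjet (\<lambda>z. w (- z)) (- x) (- p) X" using jet by (simp add: superjet_reflect)
      show "- L * (y - - x) \<le> w (- y) - w (- (- x))" if "- x < y" "y < - x0 + d" for y
        using left[of "- y" x] that x by (auto simp: algebra_simps)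
    qed (use x d in auto)
    ultimately show ?thesis by linarith
  qed
  have "convex_on {x0 - d / 2..x0 + d / 2} (\<lambda>x. w x + (C * (1 + L)) / 2 * x\<^sup>2)"
  proof (rule convex_on_of_superjets)
    show "continuous_on {x0 - d / 2..x0 + d / 2} w"
      by (rule continuous_on_subset[OF cont']) (use d in auto)
    fix x p X assume x: "x0 - d / 2 < x" "x < x0 + d / 2" "superjet w x p X"
    have "- (C * (1 + \<bar>p\<bar>)) \<le> X" using jets[of x p X] x d by auto
    moreover have "C * (1 + \<bar>p\<bar>) \<le> C * (1 + L)"
      using slope[OF x] C by (intro mult_left_mono) auto
    ultimately show "- (C * (1 + L)) \<le> X" by linarith
  qed
  then show ?thesis using d(1) by (intro exI[of _ "C * (1 + L)"] exI[of _ "d / 2"]) auto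
qed

section \<open>Sums of semiconvex functions touched from above\<close>

text \<open>
  The touching parabola bounds the difference quotients of \<open>A\<close> on the side of \<open>x\<close> opposite to \<open>y\<close>,
  and convexity passes this bound on to the quotient towards \<open>y\<close>.
\<close>

lemma convex_superjet_subgradient:
  fixes A :: "real \<Rightarrow> real"
  assumes conv: "convex_on {a..b} A" and x: "a < x" "x < b" and jet: "superjet A x P X"
    and y: "y \<in> {a..b}"
  shows "A x + P * (y - x) \<le> A y"
proof -
  have lim: "((\<lambda>t. x - t * (y - x)) \<longlongrightarrow> x - 0 * (y - x)) (at_right 0)"
    by (intro tendsto_intros)
  have inside: "\<forall>\<^sub>F t in at_right 0. x - t * (y - x) \<in> {a<..<b}"
    using lim x by (intro topological_tendstoD) auto
  have "\<forall>\<^sub>F z in nhds x. A z \<le> A x + P * (z - x) + X / 2 * (z - x)\<^sup>2"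
    using jet by (simp add: superjet_def eventually_nhds_conv_at)
  then have near: "\<forall>\<^sub>F t in at_right 0. A (x - t * (y - x)) \<le> A x + P * (x - t * (y - x) - x)
      + X / 2 * (x - t * (y - x) - x)\<^sup>2"
    using lim by (auto simp: filterlim_iff)
  have "\<forall>\<^sub>F t in at_right (0::real). A x + P * (y - x) - X / 2 * t * (y - x)\<^sup>2 \<le> A y"
    using inside near eventually_at_right_less[of 0]
  proof eventually_elim
    case (elim t)
    define s where "s = t / (1 + t)"
    have s: "0 \<le> s" "s \<le> 1" "1 - s = 1 / (1 + t)" using elim by (auto simp: s_def field_simps)
    have comb: "(1 - s) * (x - t * (y - x)) + s * y = x"
    proof -
      have "(1 - s) * (x - t * (y - x)) + s * y = (x - t * (y - x) + t * y) / (1 + t)"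
        unfolding s(3) by (simp add: s_def add_divide_distrib)
      also have "x - t * (y - x) + t * y = x * (1 + t)" by (simp add: algebra_simps)
      finally show ?thesis using elim by simp
    qed
    have "A x \<le> (1 - s) * A (x - t * (y - x)) + s * A y"
      using convex_onD[OF conv s(1,2), of "x - t * (y - x)" y] elim y comb by auto
    also have "\<dots> = (A (x - t * (y - x)) + t * A y) / (1 + t)"
      unfolding s(3) by (simp add: s_def add_divide_distrib)
    finally have "(1 + t) * A x \<le> A (x - t * (y - x)) + t * A y"
      using elim by (simp add: field_simps)
    also have "\<dots> \<le> A x - t * (P * (y - x)) + t * (X / 2 * t * (y - x)\<^sup>2) + t * A y"
      using elim by (simp add: power2_eq_square field_simps)
    finally have "t * (A x + P * (y - x) - X / 2 * t * (y - x)\<^sup>2) \<le> t * A y"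
      by (simp add: algebra_simps)
    then show ?case using elim by simp
  qed
  moreover have "((\<lambda>t. A x + P * (y - x) - X / 2 * t * (y - x)\<^sup>2) \<longlongrightarrow>
      A x + P * (y - x) - X / 2 * 0 * (y - x)\<^sup>2) (at_right 0)"
    by (intro tendsto_intros)
  then have "((\<lambda>t. A x + P * (y - x) - X / 2 * t * (y - x)\<^sup>2) \<longlongrightarrow> A x + P * (y - x)) (at_right 0)"
    by simp
  ultimately show ?thesis
    by (intro tendsto_upperbound) auto
qed

text \<open>
  Continuity at \<open>x0\<close> of the derivative, wherever it exists in the sense of superjets. No jet is
  required to exist near \<open>x0\<close>.
\<close>

definition jet_slopes_tendsto :: "(real \<Rightarrow> real) \<Rightarrow> real \<Rightarrow> real \<Rightarrow> bool" where
  "jet_slopes_tendsto w x0 p \<longleftrightarrow>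
     (\<forall>\<epsilon>>0. \<forall>\<^sub>F x in nhds x0. \<forall>q Y. superjet w x q Y \<longrightarrow> \<bar>q - p\<bar> < \<epsilon>)"

text \<open>
  At \<open>x0\<close> the function lies between its tangent and a parabola with curvature \<open>2 K\<close>. At distance
  \<open>d\<close> from \<open>x0\<close> a supporting line fits below this parabola only if its slope differs from \<open>P\<close> by
  at most \<open>4 K d\<close>.
\<close>

lemma convex_jet_slopes_tendsto:
  assumes conv: "convex_on {a..b} A" and x0: "a < x0" "x0 < b" and jet: "superjet A x0 P X"
  shows "jet_slopes_tendsto A x0 P"
  unfolding jet_slopes_tendsto_def
proof (intro allI impI)
  fix \<epsilon> :: real assume "\<epsilon> > 0"
  define K where "K = max 1 (X / 2)"
  have K: "K > 0" by (simp add: K_def)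
  have "\<forall>\<^sub>F y in nhds x0. A y \<le> A x0 + P * (y - x0) + X / 2 * (y - x0)\<^sup>2"
    using jet by (simp add: superjet_def eventually_nhds_conv_at)
  moreover have "\<forall>\<^sub>F y in nhds x0. y \<in> {a<..<b}"
    using x0 by (intro eventually_nhds_in_open) auto
  ultimately have "\<forall>\<^sub>F y in nhds x0. y \<in> {a<..<b} \<and> A y \<le> A x0 + P * (y - x0) + K * (y - x0)\<^sup>2"
  proof eventually_elim
    case (elim y)
    have "X / 2 * (y - x0)\<^sup>2 \<le> K * (y - x0)\<^sup>2" by (intro mult_right_mono) (auto simp: K_def)
    then show ?case using elim by auto
  qed
  then obtain \<eta> where \<eta>: "\<eta> > 0"
    "\<And>y. dist y x0 < \<eta> \<Longrightarrow> y \<in> {a<..<b} \<and> A y \<le> A x0 + P * (y - x0) + K * (y - x0)\<^sup>2"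
    unfolding eventually_nhds_metric by blast
  define d where "d = min (\<eta> / 2) (\<epsilon> / (8 * K))"
  have d: "d > 0" "d \<le> \<eta> / 2" using \<eta>(1) K \<open>\<epsilon> > 0\<close> by (auto simp: d_def)
  have "d \<le> \<epsilon> / (8 * K)" by (simp add: d_def)
  then have dK: "4 * K * d < \<epsilon>" using K \<open>\<epsilon> > 0\<close> by (simp add: field_simps)
  have key: "(q - P) * (y - x) \<le> K * (4 * d * d)"
    if x: "dist x x0 < d" and q: "superjet A x q Y" and y: "dist y x \<le> d" for x y q Y
  proof -
    have yx0: "\<bar>y - x0\<bar> \<le> 2 * d" using x y by (auto simp: dist_real_def)
    have xin: "x \<in> {a<..<b}" using \<eta>(2)[of x] x d by auto
    have "dist y x0 < \<eta>" using x y d by (auto simp: dist_real_def)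
    then have y': "y \<in> {a<..<b}" "A y \<le> A x0 + P * (y - x0) + K * (y - x0)\<^sup>2" using \<eta>(2) by auto
    have "A x + q * (y - x) \<le> A y"
      using convex_superjet_subgradient[OF conv _ _ q] xin y'(1) by auto
    moreover have "A x0 + P * (x - x0) \<le> A x"
      using convex_superjet_subgradient[OF conv x0 jet] xin by auto
    ultimately have "(q - P) * (y - x) \<le> K * (y - x0)\<^sup>2"
      using y'(2) by (simp add: algebra_simps)
    also have "(y - x0)\<^sup>2 \<le> (2 * d)\<^sup>2" using yx0 d(1) by (intro power2_le_iff_abs_le[THEN iffD2]) auto
    then have "K * (y - x0)\<^sup>2 \<le> K * (2 * d)\<^sup>2" using K by simp
    also have "K * (2 * d)\<^sup>2 = K * (4 * d * d)" by (simp add: power2_eq_square)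
    finally show ?thesis .
  qed
  have "\<bar>q - P\<bar> < \<epsilon>" if "dist x x0 < d" "superjet A x q Y" for x q Y
  proof -
    have "(q - P) * d \<le> (4 * K * d) * d" "(P - q) * d \<le> (4 * K * d) * d"
      using key[OF that, of "x + d"] key[OF that, of "x - d"] d(1)
      by (auto simp: dist_real_def algebra_simps)
    then have "q - P \<le> 4 * K * d" "P - q \<le> 4 * K * d"
      using d(1) mult_le_cancel_right_pos[OF d(1)] by blast+
    then show ?thesis using dK by linarith
  qed
  then show "\<forall>\<^sub>F x in nhds x0. \<forall>q Y. superjet A x q Y \<longrightarrow> \<bar>q - P\<bar> < \<epsilon>"
    using d(1) unfolding eventually_nhds_metric by blast
qed

lemma semiconvex_jet_slopes_tendsto:
  assumes conv: "convex_on {a..b} (\<lambda>x. w x + M / 2 * x\<^sup>2)" and x0: "a < x0" "x0 < b"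
    and jet: "superjet w x0 p X"
  shows "jet_slopes_tendsto w x0 p"
  unfolding jet_slopes_tendsto_def
proof (intro allI impI)
  fix \<epsilon> :: real assume "\<epsilon> > 0"
  have "superjet (\<lambda>x. w x + M / 2 * x\<^sup>2) x0 (p + M * x0) (X + M)"
    using jet unfolding superjet_add_parabola by simp
  from convex_jet_slopes_tendsto[OF conv x0 this]
  have "\<forall>\<^sub>F x in nhds x0. \<forall>q Y. superjet (\<lambda>x. w x + M / 2 * x\<^sup>2) x q Y \<longrightarrow>
      \<bar>q - (p + M * x0)\<bar> < \<epsilon> / 2"
    unfolding jet_slopes_tendsto_def using half_gt_zero[OF \<open>\<epsilon> > 0\<close>] by blast
  moreover have "((\<lambda>x. M * x) \<longlongrightarrow> M * x0) (nhds x0)"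
    by (intro tendsto_intros filterlim_ident)
  then have "\<forall>\<^sub>F x in nhds x0. dist (M * x) (M * x0) < \<epsilon> / 2"
    using half_gt_zero[OF \<open>\<epsilon> > 0\<close>] unfolding tendsto_iff by blast
  ultimately show "\<forall>\<^sub>F x in nhds x0. \<forall>q Y. superjet w x q Y \<longrightarrow> \<bar>q - p\<bar> < \<epsilon>"
  proof eventually_elim
    case (elim x)
    show ?case
    proof (intro allI impI)
      fix q Y assume "superjet w x q Y"
      then have "superjet (\<lambda>x. w x + M / 2 * x\<^sup>2) x (q + M * x) (Y + M)"
        unfolding superjet_add_parabola by simp
      then have "\<bar>q + M * x - (p + M * x0)\<bar> < \<epsilon> / 2" using elim(1) by blast
      then show "\<bar>q - p\<bar> < \<epsilon>" using elim(2) unfolding dist_real_def by arith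
    qed
  qed
qed

lemma superjet_diff_subgradient:
  assumes "superjet (\<lambda>y. A y + B y) x s X" "\<forall>\<^sub>F y in at x. B x + P * (y - x) \<le> B y"
  shows "superjet A x (s - P) X"
  using assms unfolding superjet_def
  by eventually_elim (simp add: algebra_simps)

text \<open>
  A supporting line of the second summand turns the parabola above the sum into one above the
  first. The slope of the latter is a subgradient of the first summand, which in turn gives a
  parabola above the second.
\<close>

lemma semiconvex_sum_superjet_split:
  assumes conv1: "convex_on {a..b} (\<lambda>x. w1 x + M1 / 2 * x\<^sup>2)"
    and conv2: "convex_on {a..b} (\<lambda>x. w2 x + M2 / 2 * x\<^sup>2)"
    and x0: "a < x0" "x0 < b" and jet: "superjet (\<lambda>y. w1 y + w2 y) x0 p X"
  shows "\<exists>p1 p2 X1 X2. p1 + p2 = p \<and> superjet w1 x0 p1 X1 \<and> superjet w2 x0 p2 X2"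
proof -
  define A1 where "A1 x = w1 x + M1 / 2 * x\<^sup>2" for x
  define A2 where "A2 x = w2 x + M2 / 2 * x\<^sup>2" for x
  define s where "s = p + (M1 + M2) * x0"
  define X' where "X' = X + (M1 + M2)"
  have "superjet (\<lambda>y. (w1 y + w2 y) + (M1 + M2) / 2 * y\<^sup>2) x0 s X'"
    using jet unfolding superjet_add_parabola s_def X'_def by simp
  then have sum: "superjet (\<lambda>y. A1 y + A2 y) x0 s X'"
    by (simp add: A1_def A2_def algebra_simps add_divide_distrib)
  have near: "\<forall>\<^sub>F y in at x0. y \<in> {a<..<b}"
    using x0 by (intro eventually_at_in_open') auto
  define P2 where "P2 = Inf ((\<lambda>t. (A2 x0 - A2 t) / (x0 - t)) ` ({x0<..} \<inter> {a..b}))"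
  have "\<forall>\<^sub>F y in at x0. A2 x0 + P2 * (y - x0) \<le> A2 y"
    using near
  proof eventually_elim
    case (elim y)
    then show ?case
      using convex_le_Inf_differential[OF conv2, of x0 y] x0
      by (simp add: P2_def A2_def)
  qed
  from superjet_diff_subgradient[OF sum this] have j1: "superjet A1 x0 (s - P2) X'" .
  have "\<forall>\<^sub>F y in at x0. A1 x0 + (s - P2) * (y - x0) \<le> A1 y"
    using near
  proof eventually_elim
    case (elim y)
    then show ?case
      using convex_superjet_subgradient[OF conv1 x0 j1[unfolded A1_def], of y]
      by (simp add: A1_def)
  qed
  moreover have "superjet (\<lambda>y. A2 y + A1 y) x0 s X'" using sum by (simp add: add.commute)
  ultimately have "superjet A2 x0 (s - (s - P2)) X'" by (intro superjet_diff_subgradient)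
  then have j2: "superjet A2 x0 P2 X'" by simp
  have "superjet w1 x0 (s - P2 - M1 * x0) (X' - M1)" "superjet w2 x0 (P2 - M2 * x0) (X' - M2)"
    using j1 j2 unfolding A1_def A2_def superjet_add_parabola by simp_all
  moreover have "(s - P2 - M1 * x0) + (P2 - M2 * x0) = p" by (simp add: s_def algebra_simps)
  ultimately show ?thesis by blast
qed

lemma superjet_curvature_near:
  assumes slopes: "jet_slopes_tendsto w x0 p"
    and cont: "isCont (\<lambda>(x, q). f x q) (x0, p)"
    and jets: "\<forall>\<^sub>F x in nhds x0. \<forall>q Y. superjet w x q Y \<longrightarrow> f x q \<le> Y"
    and G: "G < f x0 p"
  shows "\<forall>\<^sub>F x in nhds x0. \<forall>q Y. superjet w x q Y \<longrightarrow> G \<le> Y"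
proof -
  have "((\<lambda>(x, q). f x q) \<longlongrightarrow> f x0 p) (nhds (x0, p))"
    using cont unfolding isCont_def tendsto_at_iff_tendsto_nhds by simp
  from this G have "\<forall>\<^sub>F z in nhds (x0, p). G < (\<lambda>(x, q). f x q) z"
    by (rule order_tendstoD)
  then obtain d where d: "d > 0" "\<And>x q. dist (x, q) (x0, p) < d \<Longrightarrow> G < f x q"
    unfolding eventually_nhds_metric by auto
  have "\<forall>\<^sub>F x in nhds x0. dist x x0 < d / 2"
    using d(1) unfolding eventually_nhds_metric by (intro exI[of _ "d / 2"]) auto
  moreover have "\<forall>\<^sub>F x in nhds x0. \<forall>q Y. superjet w x q Y \<longrightarrow> \<bar>q - p\<bar> < d / 2"
    using slopes half_gt_zero[OF d(1)] unfolding jet_slopes_tendsto_def by blast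
  ultimately show ?thesis using jets
  proof eventually_elim
    case (elim x)
    show ?case
    proof (intro allI impI)
      fix q Y assume jet: "superjet w x q Y"
      have "dist (x, q) (x0, p) \<le> \<bar>dist x x0\<bar> + \<bar>dist q p\<bar>"
        unfolding dist_Pair_Pair by (rule sqrt_sum_squares_le_sum_abs)
      also have "\<dots> < d" using elim jet by (auto simp: dist_real_def)
      finally show "G \<le> Y" using d(2) elim(3) jet by fastforce
    qed
  qed
qed

text \<open>
  The one-dimensional form of the theorem on sums. The lower bounds \<open>f1\<close> and \<open>f2\<close> for second-order
  parts hold up to \<open>\<epsilon>\<close> in a whole neighbourhood because slopes converge. So \<open>w1\<close> and \<open>w2\<close> are
  convex there up to explicit parabolas, and if \<open>X\<close> were too small, a convex function would have a
  superjet with negative second-order part.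
\<close>

lemma superjet_curvature_sum:
  assumes cont: "continuous_on {a..b} w1" "continuous_on {a..b} w2" and x0: "a < x0" "x0 < b"
    and slopes: "jet_slopes_tendsto w1 x0 p1" "jet_slopes_tendsto w2 x0 p2"
    and jet: "superjet (\<lambda>y. w1 y + w2 y) x0 p X"
    and f1: "isCont (\<lambda>(x, q). f1 x q) (x0, p1)"
      "\<forall>\<^sub>F x in nhds x0. \<forall>q Y. superjet w1 x q Y \<longrightarrow> f1 x q \<le> Y"
    and f2: "isCont (\<lambda>(x, q). f2 x q) (x0, p2)"
      "\<forall>\<^sub>F x in nhds x0. \<forall>q Y. superjet w2 x q Y \<longrightarrow> f2 x q \<le> Y"
  shows "f1 x0 p1 + f2 x0 p2 \<le> X"
proof (rule ccontr)
  assume gap: "\<not> ?thesis"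
  define \<epsilon> where "\<epsilon> = (f1 x0 p1 + f2 x0 p2 - X) / 3"
  have \<epsilon>: "\<epsilon> > 0" using gap by (simp add: \<epsilon>_def)
  define G where "G = f1 x0 p1 - \<epsilon>"
  define H where "H = f2 x0 p2 - \<epsilon>"
  have "\<forall>\<^sub>F x in nhds x0. \<forall>q Y. superjet w1 x q Y \<longrightarrow> G \<le> Y"
    by (rule superjet_curvature_near[OF slopes(1) f1]) (use \<epsilon> in \<open>simp add: G_def\<close>)
  moreover have "\<forall>\<^sub>F x in nhds x0. \<forall>q Y. superjet w2 x q Y \<longrightarrow> H \<le> Y"
    by (rule superjet_curvature_near[OF slopes(2) f2]) (use \<epsilon> in \<open>simp add: H_def\<close>)
  moreover have "\<forall>\<^sub>F x in nhds x0. x \<in> {a<..<b}"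
    using x0 by (intro eventually_nhds_in_open) auto
  ultimately have "\<forall>\<^sub>F x in nhds x0. x \<in> {a<..<b} \<and> (\<forall>q Y. superjet w1 x q Y \<longrightarrow> G \<le> Y) \<and>
      (\<forall>q Y. superjet w2 x q Y \<longrightarrow> H \<le> Y)"
    by eventually_elim auto
  then obtain d where d: "d > 0" "\<And>x. dist x x0 < d \<Longrightarrow> x \<in> {a<..<b} \<and>
      (\<forall>q Y. superjet w1 x q Y \<longrightarrow> G \<le> Y) \<and> (\<forall>q Y. superjet w2 x q Y \<longrightarrow> H \<le> Y)"
    unfolding eventually_nhds_metric by blast
  define I where "I = {x0 - d / 2..x0 + d / 2}"
  have I: "dist x x0 < d" if "x \<in> I" for x
    using that d(1) by (auto simp: I_def dist_real_def)
  have sub: "I \<subseteq> {a..b}" using I d(2) by fastforce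
  have conv1: "convex_on I (\<lambda>x. w1 x + (- G) / 2 * x\<^sup>2)"
    unfolding I_def
  proof (rule convex_on_of_superjets)
    show "continuous_on {x0 - d / 2..x0 + d / 2} w1"
      using continuous_on_subset[OF cont(1) sub] by (simp add: I_def)
    show "- (- G) \<le> Y" if "x0 - d / 2 < x" "x < x0 + d / 2" "superjet w1 x q Y" for x q Y
      using d(2)[OF I, of x] that by (auto simp: I_def)
  qed
  have conv2: "convex_on I (\<lambda>x. w2 x + (- H) / 2 * x\<^sup>2)"
    unfolding I_def
  proof (rule convex_on_of_superjets)
    show "continuous_on {x0 - d / 2..x0 + d / 2} w2"
      using continuous_on_subset[OF cont(2) sub] by (simp add: I_def)
    show "- (- H) \<le> Y" if "x0 - d / 2 < x" "x < x0 + d / 2" "superjet w2 x q Y" for x q Y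
      using d(2)[OF I, of x] that by (auto simp: I_def)
  qed
  define E where "E x = (w1 x + w2 x) + (- (G + H)) / 2 * x\<^sup>2" for x
  define P where "P = p + (- (G + H)) * x0"
  have "convex_on I (\<lambda>x. (w1 x + (- G) / 2 * x\<^sup>2) + (w2 x + (- H) / 2 * x\<^sup>2))"
    by (rule convex_on_add[OF conv1 conv2])
  also have "(\<lambda>x. (w1 x + (- G) / 2 * x\<^sup>2) + (w2 x + (- H) / 2 * x\<^sup>2)) = E"
    by (auto simp: E_def field_simps)
  finally have conv: "convex_on I E" .
  have "P - - (G + H) * x0 = p" "- \<epsilon> - - (G + H) = X"
    by (simp_all add: P_def G_def H_def \<epsilon>_def field_simps)
  then have jetE: "superjet E x0 P (- \<epsilon>)"
    unfolding E_def superjet_add_parabola using jet by simp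
  have "\<forall>\<^sub>F y in at x0. y \<in> I"
    using eventually_at_in_open'[of "{x0 - d / 2<..<x0 + d / 2}" x0] d(1)
    by (auto simp: I_def elim: eventually_mono)
  moreover have "\<forall>\<^sub>F y in at x0. y \<noteq> x0" by (auto simp: eventually_at intro: exI[of _ 1])
  ultimately have "\<forall>\<^sub>F y in at x0. False"
    using jetE[unfolded superjet_def]
  proof eventually_elim
    case (elim y)
    have "E x0 + P * (y - x0) \<le> E y"
      using convex_superjet_subgradient[OF conv[unfolded I_def] _ _ jetE] elim(1) d(1)
      by (simp add: I_def)
    moreover have "- \<epsilon> / 2 * (y - x0)\<^sup>2 < 0" using \<epsilon> elim(2) by (intro mult_neg_pos) auto
    ultimately show ?case using elim(3) by linarith
  qed
  then show False by simp
qed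

section \<open>Elementary estimates\<close>

text \<open>
  The derivative of \<open>ln\<close> is at most \<open>c1\<close> on \<open>[1 / c1, \<infinity>)\<close>. The maximum covers a negative shift,
  where monotonicity suffices.
\<close>

lemma ln_slope_shift:
  fixes p q c1 :: real
  assumes "c1 > 0" "p \<le> - (1 / c1)" "p - q < 0"
  shows "ln (- (p - q)) - ln (- p) \<le> c1 * max q 0"
proof -
  have p: "- p > 0" using assms(1,2) zero_less_divide_1_iff[of c1] by linarith
  show ?thesis
  proof (cases "q \<ge> 0")
    case True
    have "ln (- (p - q)) - ln (- p) = ln (- (p - q) / - p)"
      using p assms(3) by (subst ln_div) auto
    also have "\<dots> \<le> - (p - q) / - p - 1"
      using p assms(3) by (intro ln_le_minus_one divide_pos_pos) auto
    also have "\<dots> = q / - p" using p by (simp add: field_simps)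
    also have "\<dots> \<le> q / (1 / c1)"
      using True p assms(1,2) by (intro divide_left_mono mult_pos_pos divide_pos_pos) auto
    finally show ?thesis using True by (simp add: mult.commute)
  next
    case False
    then have "ln (- (p - q)) \<le> ln (- p)" using p assms(3) by (intro ln_mono) auto
    then show ?thesis using False by simp
  qed
qed

lemma continuous_Icc_bound:
  fixes f :: "real \<Rightarrow> real"
  assumes "continuous_on {a..b} f"
  shows "\<exists>N\<ge>0. \<forall>x\<in>{a..b}. \<bar>f x\<bar> \<le> N"
proof -
  have "bounded (f ` {a..b})"
    using assms by (intro compact_imp_bounded compact_continuous_image) auto
  then obtain N where "\<forall>y\<in>f ` {a..b}. \<bar>y\<bar> \<le> N"
    unfolding bounded_iff by (metis real_norm_def)
  then show ?thesis by (intro exI[of _ "max N 0"]) force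
qed

lemma recycling_rate_lipschitz:
  assumes "recycling_rate b \<rho> r"
  shows "\<exists>L\<ge>0. \<forall>x\<in>{0..d}. \<forall>y\<in>{0..d}. \<bar>r x - r y\<bar> \<le> L * \<bar>x - y\<bar>"
proof -
  obtain r' where r': "\<And>x. x \<ge> 0 \<Longrightarrow> (r has_real_derivative r' x) (at x within {0..})"
    "continuous_on {0..} r'"
    using assms by (auto simp: recycling_rate_def)
  obtain L where L: "L \<ge> 0" "\<And>x. x \<in> {0..d} \<Longrightarrow> \<bar>r' x\<bar> \<le> L"
    using continuous_Icc_bound[of 0 d r'] continuous_on_subset[OF r'(2), of "{0..d}"] by auto
  have "\<bar>r x - r y\<bar> \<le> L * \<bar>x - y\<bar>" if "x \<in> {0..d}" "y \<in> {0..d}" for x y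
    using field_differentiable_bound[of "{0..d}" r r' L x y] L(2) that
      has_field_derivative_subset[OF r'(1), of _ "{0..d}"] by auto
  then show ?thesis using L(1) by blast
qed

lemma recycling_rate_continuous:
  assumes "recycling_rate b \<rho> r"
  shows "continuous_on {0..} r"
  using assms unfolding recycling_rate_def continuous_on_eq_continuous_within
  by (auto dest: DERIV_continuous)

lemma recycling_rate_bounded:
  assumes "recycling_rate b \<rho> r"
  shows "\<exists>a\<ge>0. \<forall>x\<ge>0. r x \<le> a"
proof -
  obtain a where mono: "mono_on {0..} r" and lim: "(r \<longlongrightarrow> a) at_top" and r0: "r 0 = 0"
    using assms by (auto simp: recycling_rate_def)
  have le: "r x \<le> a" if "x \<ge> 0" for x
  proof (rule tendsto_lowerbound[OF lim])
    show "\<forall>\<^sub>F y in at_top. r x \<le> r y"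
      using eventually_ge_at_top[of x] by eventually_elim (use that mono in \<open>auto simp: mono_on_def\<close>)
  qed simp
  with le[of 0] r0 show ?thesis by auto
qed

section \<open>The difference of a subsolution and a supersolution, elliptic case\<close>

locale sub_super_pair =
  fixes b c \<rho> \<sigma> c1 :: real and r u v :: "real \<Rightarrow> real"
  assumes c1: "c1 > 0"
    and r: "recycling_rate b \<rho> r"
    and u_cont: "continuous_on {0..} u"
    and v_cont: "continuous_on {0..} v"
    and u_sub: "viscosity_subsolution b c \<rho> \<sigma> r {0..} u"
    and u_slope: "viscosity_deriv_le {0<..} u (- (1 / c1))"
    and v_super: "viscosity_supersolution b c \<rho> \<sigma> r {0<..} v"
begin

abbreviation F where "F \<equiv> first_order_part b c \<rho> r"

lemma isCont_coefficients:
  assumes "x > 0"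
  shows "isCont u x" "isCont v x" "isCont r x"
  using assms u_cont v_cont recycling_rate_continuous[OF r]
  by (auto intro: continuous_on_interior simp: interior_Ici)

lemma u_jet:
  assumes "x > 0" "superjet u x p X"
  shows "p \<le> - (1 / c1)" "F x (u x) p \<le> \<sigma>\<^sup>2 / 2 * x\<^sup>2 * X"
  using subsolution_superjet[OF u_sub u_slope c1 assms] .

lemma v_jet:
  assumes "x > 0" "superjet (\<lambda>y. - v y) x q Y"
  shows "0 < q" "- (\<sigma>\<^sup>2 / 2 * x\<^sup>2 * Y) \<le> F x (v x) (- q)"
  using supersolution_subjet[OF v_super assms(1), of "- q" "- Y"] assms(2) by auto

text \<open>
  Solving the equation for the second-order term. For \<open>u\<close> the logarithm is bounded below because
  the slope is at most \<open>- 1 / c1\<close>; for \<open>- v\<close> an upper bound is needed, and \<open>ln\<close> grows at most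
  linearly.
\<close>

lemma jet_curvature_lower_bound:
  assumes "0 < \<alpha>" "\<sigma> \<noteq> 0"
  shows "\<exists>C>0. \<forall>x\<in>{\<alpha>..\<beta>}. \<forall>q Y.
    (superjet u x q Y \<longrightarrow> - (C * (1 + \<bar>q\<bar>)) \<le> Y) \<and>
    (superjet (\<lambda>y. - v y) x q Y \<longrightarrow> - (C * (1 + \<bar>q\<bar>)) \<le> Y)"
proof -
  have sub: "{\<alpha>..\<beta>} \<subseteq> {0..}" using assms by auto
  note cont = u_cont[THEN continuous_on_subset, OF sub] v_cont[THEN continuous_on_subset, OF sub]
    recycling_rate_continuous[OF r, THEN continuous_on_subset, OF sub]
  have "continuous_on {\<alpha>..\<beta>} (\<lambda>x. \<rho> * u x + c * x\<^sup>2 + 1)"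
    by (intro continuous_intros cont)
  from continuous_Icc_bound[OF this] obtain N1 where N1: "N1 \<ge> 0"
    "\<And>x. x \<in> {\<alpha>..\<beta>} \<Longrightarrow> \<bar>\<rho> * u x + c * x\<^sup>2 + 1\<bar> \<le> N1" by blast
  have "continuous_on {\<alpha>..\<beta>} (\<lambda>x. \<rho> * v x + c * x\<^sup>2 + 1)"
    by (intro continuous_intros cont)
  from continuous_Icc_bound[OF this] obtain N2 where N2: "N2 \<ge> 0"
    "\<And>x. x \<in> {\<alpha>..\<beta>} \<Longrightarrow> \<bar>\<rho> * v x + c * x\<^sup>2 + 1\<bar> \<le> N2" by blast
  have "continuous_on {\<alpha>..\<beta>} (\<lambda>x. b * x - r x)"
    by (intro continuous_intros cont)
  from continuous_Icc_bound[OF this] obtain R where R: "R \<ge> 0"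
    "\<And>x. x \<in> {\<alpha>..\<beta>} \<Longrightarrow> \<bar>b * x - r x\<bar> \<le> R" by blast
  define N where "N = N1 + N2 + R + 1 + \<bar>ln c1\<bar>"
  have N: "N > 0" using N1 N2 R by (simp add: N_def)
  define C where "C = 2 * N / (\<sigma>\<^sup>2 * \<alpha>\<^sup>2)"
  have C: "C > 0" using N assms by (simp add: C_def)
  have scale: "- (C * (1 + \<bar>q\<bar>)) \<le> Y"
    if x: "x \<in> {\<alpha>..\<beta>}" and le: "- (N * (1 + \<bar>q\<bar>)) \<le> \<sigma>\<^sup>2 / 2 * x\<^sup>2 * Y" for x q Y
  proof (cases "Y \<ge> 0")
    case True
    have "0 \<le> C * (1 + \<bar>q\<bar>)" using C by simp
    then show ?thesis using True by linarith
  next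
    case False
    have "\<alpha>\<^sup>2 \<le> x\<^sup>2" using x assms by (intro power_mono) auto
    then have "\<sigma>\<^sup>2 / 2 * \<alpha>\<^sup>2 \<le> \<sigma>\<^sup>2 / 2 * x\<^sup>2" by (intro mult_left_mono) auto
    then have "\<sigma>\<^sup>2 / 2 * x\<^sup>2 * Y \<le> \<sigma>\<^sup>2 / 2 * \<alpha>\<^sup>2 * Y"
      using False by (intro mult_right_mono_neg) auto
    with le have "- (N * (1 + \<bar>q\<bar>)) \<le> \<sigma>\<^sup>2 / 2 * \<alpha>\<^sup>2 * Y" by linarith
    moreover have "\<sigma>\<^sup>2 * \<alpha>\<^sup>2 > 0" using assms by simp
    ultimately show ?thesis by (simp add: C_def field_simps)
  qed
  have prod: "\<bar>(b * x - r x) * q\<bar> \<le> R * \<bar>q\<bar>" if "x \<in> {\<alpha>..\<beta>}" for x q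
    using R(2)[OF that] by (simp add: abs_mult mult_right_mono)
  have Nq: "(N1 + N2 + 1 + \<bar>ln c1\<bar>) + R * \<bar>q\<bar> + \<bar>q\<bar> \<le> N * (1 + \<bar>q\<bar>)" for q
  proof -
    have "0 \<le> (N1 + N2 + \<bar>ln c1\<bar>) * \<bar>q\<bar>" using N1 N2 by simp
    then show ?thesis using R by (simp add: N_def algebra_simps)
  qed
  show ?thesis
  proof (intro exI[of _ C] conjI ballI allI impI C)
    fix x q Y assume x: "x \<in> {\<alpha>..\<beta>}" and jet: "superjet u x q Y"
    have x': "x > 0" using x assms by auto
    have "ln (1 / c1) \<le> ln (- q)"
      using u_jet(1)[OF x' jet] c1 by (intro ln_mono) auto
    then have "- \<bar>ln c1\<bar> \<le> ln (- q)" using c1 by (simp add: ln_div)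
    then have "- ((N1 + N2 + 1 + \<bar>ln c1\<bar>) + R * \<bar>q\<bar> + \<bar>q\<bar>) \<le> F x (u x) q"
      using N1(2)[OF x] prod[OF x, of q] N2(1) by (simp add: first_order_part_def)
    then show "- (C * (1 + \<bar>q\<bar>)) \<le> Y"
      using u_jet(2)[OF x' jet] Nq[of q] by (intro scale[OF x]) linarith
  next
    fix x q Y assume x: "x \<in> {\<alpha>..\<beta>}" and jet: "superjet (\<lambda>y. - v y) x q Y"
    have x': "x > 0" using x assms by auto
    have "ln q \<le> \<bar>q\<bar>" using ln_le_minus_one[OF v_jet(1)[OF x' jet]] by simp
    then have "F x (v x) (- q) \<le> (N1 + N2 + 1 + \<bar>ln c1\<bar>) + R * \<bar>q\<bar> + \<bar>q\<bar>"
      using N2(2)[OF x] prod[OF x, of "- q"] N1(1) by (simp add: first_order_part_def)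
    then show "- (C * (1 + \<bar>q\<bar>)) \<le> Y"
      using v_jet(2)[OF x' jet] Nq[of q] by (intro scale[OF x]) linarith
  qed
qed

text \<open>
  In the second-order bounds \<open>f1\<close> and \<open>f2\<close> the slopes at \<open>x0\<close> differ by \<open>p\<close>, so their sum contains
  the logarithms only through a difference, which \<open>ln_slope_shift\<close> controls.
\<close>

lemma difference_jet_elliptic:
  assumes \<sigma>: "\<sigma> \<noteq> 0" and x0: "x0 > 0" and jet: "superjet (\<lambda>y. u y - v y) x0 p X"
  shows "\<rho> * (u x0 - v x0) + (b * x0 - r x0) * p - c1 * max p 0 - \<sigma>\<^sup>2 / 2 * x0\<^sup>2 * X \<le> 0"
proof -
  define \<alpha> where "\<alpha> = x0 / 2"
  define \<beta> where "\<beta> = 2 * x0"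
  have ab: "0 < \<alpha>" "\<alpha> < x0" "x0 < \<beta>" using x0 by (auto simp: \<alpha>_def \<beta>_def)
  have cont: "continuous_on {\<alpha>..\<beta>} u" "continuous_on {\<alpha>..\<beta>} (\<lambda>y. - v y)"
    using ab by (auto intro!: continuous_on_subset[OF u_cont] continuous_on_minus
        continuous_on_subset[OF v_cont])
  obtain C where C: "C > 0"
    "\<And>x q Y. x \<in> {\<alpha>..\<beta>} \<Longrightarrow> superjet u x q Y \<Longrightarrow> - (C * (1 + \<bar>q\<bar>)) \<le> Y"
    "\<And>x q Y. x \<in> {\<alpha>..\<beta>} \<Longrightarrow> superjet (\<lambda>y. - v y) x q Y \<Longrightarrow> - (C * (1 + \<bar>q\<bar>)) \<le> Y"
    using jet_curvature_lower_bound[OF ab(1) \<sigma>, of \<beta>] by blast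
  have "\<exists>M \<delta>. 0 < \<delta> \<and> convex_on {x0 - \<delta>..x0 + \<delta>} (\<lambda>x. u x + M / 2 * x\<^sup>2)"
    by (rule semiconvex_near[OF cont(1) ab(2,3) _ C(1)], rule C(2)[rotated], assumption, simp)
  then obtain M1 \<delta>1 where 1: "\<delta>1 > 0"
    "convex_on {x0 - \<delta>1..x0 + \<delta>1} (\<lambda>x. u x + M1 / 2 * x\<^sup>2)" by blast
  have "\<exists>M \<delta>. 0 < \<delta> \<and> convex_on {x0 - \<delta>..x0 + \<delta>} (\<lambda>x. - v x + M / 2 * x\<^sup>2)"
    by (rule semiconvex_near[OF cont(2) ab(2,3) _ C(1)], rule C(3)[rotated], assumption, simp)
  then obtain M2 \<delta>2 where 2: "\<delta>2 > 0"
    "convex_on {x0 - \<delta>2..x0 + \<delta>2} (\<lambda>x. - v x + M2 / 2 * x\<^sup>2)" by blast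
  define \<delta> where "\<delta> = min \<delta>1 \<delta>2"
  have \<delta>: "\<delta> > 0" using 1 2 by (simp add: \<delta>_def)
  have conv: "convex_on {x0 - \<delta>..x0 + \<delta>} (\<lambda>x. u x + M1 / 2 * x\<^sup>2)"
    "convex_on {x0 - \<delta>..x0 + \<delta>} (\<lambda>x. - v x + M2 / 2 * x\<^sup>2)"
    by (rule convex_on_subset[OF 1(2)] convex_on_subset[OF 2(2)]; auto simp: \<delta>_def)+
  have jet': "superjet (\<lambda>y. u y + - v y) x0 p X" using jet by simp
  have int: "x0 - \<delta> < x0" "x0 < x0 + \<delta>" using \<delta> by auto
  obtain p1 p2 X1 X2 where split: "p1 + p2 = p" "superjet u x0 p1 X1"
    "superjet (\<lambda>y. - v y) x0 p2 X2"
    using semiconvex_sum_superjet_split[OF conv int jet'] by blast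
  have p1: "p1 \<le> - (1 / c1)" and p2: "p2 > 0"
    using u_jet(1)[OF x0 split(2)] v_jet(1)[OF x0 split(3)] by auto
  have "p1 < 0" using p1 c1 zero_less_divide_1_iff[of c1] by linarith
  define f1 where "f1 x q = 2 / (\<sigma>\<^sup>2 * x\<^sup>2) * F x (u x) q" for x q
  define f2 where "f2 x q = - (2 / (\<sigma>\<^sup>2 * x\<^sup>2) * F x (v x) (- q))" for x q
  have comp: "isCont (\<lambda>z. g (fst z)) (x0, q)" if "isCont g x0" for g :: "real \<Rightarrow> real" and q :: real
    using that by (intro isCont_o2[of _ fst g]) auto
  note comp = isCont_coefficients[OF x0, THEN comp]
  have cf1: "isCont (\<lambda>(x, q). f1 x q) (x0, p1)"
    unfolding f1_def case_prod_unfold first_order_part_def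
    using \<sigma> x0 \<open>p1 < 0\<close> by (intro continuous_intros comp) auto
  have cf2: "isCont (\<lambda>(x, q). f2 x q) (x0, p2)"
    unfolding f2_def case_prod_unfold first_order_part_def
    using \<sigma> x0 p2 by (intro continuous_intros comp) auto
  have pos: "\<forall>\<^sub>F x in nhds x0. x > 0"
    using eventually_nhds_in_open[of "{0<..}" x0] x0 by simp
  have f1: "\<forall>\<^sub>F x in nhds x0. \<forall>q Y. superjet u x q Y \<longrightarrow> f1 x q \<le> Y"
    using pos
  proof eventually_elim
    case (elim x)
    have "\<sigma>\<^sup>2 * x\<^sup>2 > 0" using \<sigma> elim by simp
    then show ?case using u_jet(2)[OF elim] by (auto simp: f1_def field_simps)
  qed
  have f2: "\<forall>\<^sub>F x in nhds x0. \<forall>q Y. superjet (\<lambda>y. - v y) x q Y \<longrightarrow> f2 x q \<le> Y"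
    using pos
  proof eventually_elim
    case (elim x)
    have s: "\<sigma>\<^sup>2 * x\<^sup>2 > 0" using \<sigma> elim by simp
    show ?case
    proof (intro allI impI)
      fix q Y assume "superjet (\<lambda>y. - v y) x q Y"
      from v_jet(2)[OF elim this] have "- F x (v x) (- q) * 2 \<le> Y * (\<sigma>\<^sup>2 * x\<^sup>2)" by (simp add: mult_ac)
      then have "(- F x (v x) (- q) * 2) / (\<sigma>\<^sup>2 * x\<^sup>2) \<le> Y" using s by (simp only: pos_divide_le_eq)
      then show "f2 x q \<le> Y" by (simp add: f2_def mult.commute)
    qed
  qed
  have "f1 x0 p1 + f2 x0 p2 \<le> X"
    by (rule superjet_curvature_sum[OF cont ab(2,3)
          semiconvex_jet_slopes_tendsto[OF conv(1) int split(2)]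
          semiconvex_jet_slopes_tendsto[OF conv(2) int split(3)] jet' cf1 f1 cf2 f2])
  then have "(2 / (\<sigma>\<^sup>2 * x0\<^sup>2)) * (F x0 (u x0) p1 - F x0 (v x0) (- p2)) \<le> X"
    by (simp add: f1_def f2_def right_diff_distrib)
  moreover have s: "\<sigma>\<^sup>2 * x0\<^sup>2 > 0" using \<sigma> x0 by simp
  ultimately have main: "F x0 (u x0) p1 - F x0 (v x0) (- p2) \<le> \<sigma>\<^sup>2 / 2 * x0\<^sup>2 * X"
    by (simp add: field_simps)
  have p2': "- p2 = p1 - p" using split(1) by simp
  have "ln (- (p1 - p)) - ln (- p1) \<le> c1 * max p 0"
    by (rule ln_slope_shift[OF c1 p1]) (use p2 p2' in linarith)
  then show ?thesis
    using main unfolding p2' by (simp add: first_order_part_def algebra_simps)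
qed

end

section \<open>The difference of a subsolution and a supersolution, first-order case\<close>

text \<open>
  The penalization principle behind the doubling of variables. At a limit of the maximum points the
  penalty has forced both variables to agree, and the strict maximum at \<open>x0\<close> leaves no other limit;
  comparing values shows that the penalty itself tends to \<open>0\<close>.
\<close>

lemma doubled_maxima_converge:
  fixes f g :: "real \<Rightarrow> real"
  assumes I: "compact I" and cont: "continuous_on I f" "continuous_on I g" and x0: "x0 \<in> I"
    and strict: "\<And>y. y \<in> I \<Longrightarrow> f y - g y \<le> f x0 - g x0 - (y - x0)\<^sup>2"
  obtains N x y where "\<And>n. x n \<in> I" "\<And>n. y n \<in> I"
    "\<And>n \<xi> \<eta>. \<xi> \<in> I \<Longrightarrow> \<eta> \<in> I \<Longrightarrow>
      f \<xi> - g \<eta> - N n / 2 * (\<xi> - \<eta>)\<^sup>2 \<le> f (x n) - g (y n) - N n / 2 * (x n - y n)\<^sup>2"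
    "x \<longlonglongrightarrow> x0" "y \<longlonglongrightarrow> x0" "(\<lambda>n. N n * (x n - y n)\<^sup>2) \<longlonglongrightarrow> 0"
proof -
  define \<Phi> where "\<Phi> N z = f (fst z) - g (snd z) - N / 2 * (fst z - snd z)\<^sup>2" for N z
  have "\<exists>z\<in>I \<times> I. \<forall>w\<in>I \<times> I. \<Phi> (real n) w \<le> \<Phi> (real n) z" for n
  proof (rule continuous_attains_sup)
    show "compact (I \<times> I)" by (intro compact_Times I)
    show "continuous_on (I \<times> I) (\<Phi> (real n))"
      unfolding \<Phi>_def
      by (intro continuous_intros continuous_on_compose2[OF cont(1)] continuous_on_compose2[OF cont(2)])
        auto
  qed (use x0 in auto)
  then obtain z where z: "\<And>n. z n \<in> I \<times> I"
    "\<And>n w. w \<in> I \<times> I \<Longrightarrow> \<Phi> (real n) w \<le> \<Phi> (real n) (z n)" by metis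
  have "compact (I \<times> I)" by (intro compact_Times I)
  then obtain l s where l: "l \<in> I \<times> I" "strict_mono s" "(z \<circ> s) \<longlonglongrightarrow> l"
    using z(1) unfolding compact_def by blast
  define x where "x n = fst (z (s n))" for n
  define y where "y n = snd (z (s n))" for n
  have xy: "x n \<in> I" "y n \<in> I" for n using z(1)[of "s n"] by (auto simp: x_def y_def mem_Times_iff)
  have lim: "x \<longlonglongrightarrow> fst l" "y \<longlonglongrightarrow> snd l"
    using tendsto_fst[OF l(3)] tendsto_snd[OF l(3)] by (simp_all add: x_def[abs_def] y_def[abs_def] o_def)
  have l': "fst l \<in> I" "snd l \<in> I" using l(1) by (auto simp: mem_Times_iff)
  have flim: "(\<lambda>n. f (x n)) \<longlonglongrightarrow> f (fst l)" "(\<lambda>n. g (y n)) \<longlonglongrightarrow> g (snd l)"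
    using continuous_on_tendsto_compose[OF cont(1) lim(1) l'(1)]
      continuous_on_tendsto_compose[OF cont(2) lim(2) l'(2)] xy by auto
  define E where "E n = f (x n) - g (y n) - (f x0 - g x0)" for n
  have pen: "real (s n) / 2 * (x n - y n)\<^sup>2 \<le> E n" for n
    using z(2)[of "(x0, x0)" "s n"] x0 by (simp add: \<Phi>_def x_def y_def E_def)
  have Elim: "E \<longlonglongrightarrow> f (fst l) - g (snd l) - (f x0 - g x0)"
    unfolding E_def by (intro tendsto_intros flim)
  have sinf: "filterlim (\<lambda>n. real (s n)) at_top sequentially"
    by (rule filterlim_compose[OF filterlim_real_sequentially filterlim_subseq[OF l(2)]])
  have nonneg: "\<forall>\<^sub>F n in sequentially. 0 \<le> (x n - y n)\<^sup>2" by simp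
  have quot: "(\<lambda>n. 2 * E n / real (s n)) \<longlonglongrightarrow> 0"
    by (rule real_tendsto_divide_at_top[OF tendsto_mult[OF tendsto_const Elim] sinf])
  have "\<forall>\<^sub>F n in sequentially. (x n - y n)\<^sup>2 \<le> 2 * E n / real (s n)"
    using filterlim_at_top_dense[THEN iffD1, OF sinf, rule_format, of 0]
  proof eventually_elim
    case (elim n)
    then show ?case using pen[of n] by (simp add: field_simps)
  qed
  from tendsto_sandwich[OF nonneg this tendsto_const quot]
  have "(\<lambda>n. (x n - y n)\<^sup>2) \<longlonglongrightarrow> 0" .
  moreover have "(\<lambda>n. (x n - y n)\<^sup>2) \<longlonglongrightarrow> (fst l - snd l)\<^sup>2" by (intro tendsto_intros lim)
  ultimately have "(fst l - snd l)\<^sup>2 = 0" using LIMSEQ_unique by blast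
  then have diag: "snd l = fst l" by simp
  have "0 \<le> E n" for n
  proof -
    have "0 \<le> real (s n) / 2 * (x n - y n)\<^sup>2" by simp
    then show ?thesis using pen[of n] by (rule order_trans)
  qed
  then have "0 \<le> f (fst l) - g (snd l) - (f x0 - g x0)"
    by (intro LIMSEQ_le_const[OF Elim]) auto
  with strict[OF l'(1)] have "(fst l - x0)\<^sup>2 \<le> 0" unfolding diag by linarith
  then have l0: "fst l = x0" by simp
  then have "E \<longlonglongrightarrow> 0" using Elim diag by simp
  then have twice: "(\<lambda>n. 2 * E n) \<longlonglongrightarrow> 0" using tendsto_mult_right_zero by blast
  have nonneg': "\<forall>\<^sub>F n in sequentially. 0 \<le> real (s n) * (x n - y n)\<^sup>2" by simp
  have "\<forall>\<^sub>F n in sequentially. real (s n) * (x n - y n)\<^sup>2 \<le> 2 * E n"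
    using pen by (simp add: field_simps)
  from tendsto_sandwich[OF nonneg' this tendsto_const twice]
  have pen0: "(\<lambda>n. real (s n) * (x n - y n)\<^sup>2) \<longlonglongrightarrow> 0" .
  have "f \<xi> - g \<eta> - real (s n) / 2 * (\<xi> - \<eta>)\<^sup>2 \<le> f (x n) - g (y n) - real (s n) / 2 * (x n - y n)\<^sup>2"
    if "\<xi> \<in> I" "\<eta> \<in> I" for n \<xi> \<eta>
    using z(2)[of "(\<xi>, \<eta>)" "s n"] that by (simp add: \<Phi>_def x_def y_def)
  from that[OF xy this lim[unfolded diag l0] pen0] show thesis .
qed

lemma superjet_of_interior_max:
  assumes "x \<in> {a<..<b}"
    and "\<And>y. y \<in> {a..b} \<Longrightarrow> w y - (A + B * y + D / 2 * y\<^sup>2) \<le> w x - (A + B * x + D / 2 * x\<^sup>2)"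
  shows "superjet w x (B + D * x) D"
proof -
  have "\<forall>\<^sub>F y in at x. y \<in> {a<..<b}"
    using assms(1) by (intro eventually_at_in_open') auto
  then show ?thesis
    unfolding superjet_def
  proof eventually_elim
    case (elim y)
    have "(B + D * x) * (y - x) + D / 2 * (y - x)\<^sup>2 =
        (A + B * y + D / 2 * y\<^sup>2) - (A + B * x + D / 2 * x\<^sup>2)"
      by (simp add: power2_eq_square field_simps)
    then show ?case using assms(2)[of y] elim by auto
  qed
qed

context sub_super_pair
begin

text \<open>
  The two inequalities at the doubled maximum carry the slopes \<open>q n + \<pi> n\<close> and \<open>q n\<close>, where \<open>q n\<close> may
  be unbounded and \<open>\<pi> n\<close> tends to \<open>p\<close>. The difference of the drift terms stays under control because
  the Lipschitz bound for \<open>r\<close> produces exactly the penalty, which tends to \<open>0\<close>.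
\<close>

lemma difference_jet_first_order:
  assumes \<sigma>: "\<sigma> = 0" and x0: "x0 > 0" and jet: "superjet (\<lambda>y. u y - v y) x0 p X"
  shows "\<rho> * (u x0 - v x0) + (b * x0 - r x0) * p - c1 * max p 0 \<le> 0"
proof -
  have "\<forall>\<^sub>F y in nhds x0. u y - v y \<le> u x0 - v x0 + p * (y - x0) + X / 2 * (y - x0)\<^sup>2"
    using jet by (simp add: superjet_def eventually_nhds_conv_at)
  then obtain e where e: "e > 0" "\<And>y. dist y x0 < e \<Longrightarrow>
      u y - v y \<le> u x0 - v x0 + p * (y - x0) + X / 2 * (y - x0)\<^sup>2"
    unfolding eventually_nhds_metric by blast
  define d where "d = min (e / 2) (x0 / 2)"
  have d: "d > 0" "x0 - d > 0" "d < e" using e(1) x0 by (auto simp: d_def)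
  define I where "I = {x0 - d..x0 + d}"
  have I0: "I \<subseteq> {0..}" using d by (auto simp: I_def)
  have cI: "compact I" and x0I: "x0 \<in> I" using d(1) by (auto simp: I_def)
  \<comment> \<open>the additional \<open>(y - x0)\<^sup>2\<close> makes the maximum at \<open>x0\<close> strict\<close>
  define f where "f y = u y - (p * (y - x0) + (X / 2 + 1) * (y - x0)\<^sup>2)" for y
  have fcont: "continuous_on I f"
    unfolding f_def by (intro continuous_intros continuous_on_subset[OF u_cont I0])
  have strict: "f y - v y \<le> f x0 - v x0 - (y - x0)\<^sup>2" if "y \<in> I" for y
  proof -
    have "dist y x0 < e" using that d(3) by (auto simp: I_def dist_real_def)
    from e(2)[OF this] show ?thesis by (simp add: f_def algebra_simps)
  qed
  obtain N x y where mem: "\<And>n. x n \<in> I" "\<And>n. y n \<in> I"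
    and max: "\<And>n \<xi> \<eta>. \<xi> \<in> I \<Longrightarrow> \<eta> \<in> I \<Longrightarrow>
        f \<xi> - v \<eta> - N n / 2 * (\<xi> - \<eta>)\<^sup>2 \<le> f (x n) - v (y n) - N n / 2 * (x n - y n)\<^sup>2"
    and lim: "x \<longlonglongrightarrow> x0" "y \<longlonglongrightarrow> x0" "(\<lambda>n. N n * (x n - y n)\<^sup>2) \<longlonglongrightarrow> 0"
    by (rule doubled_maxima_converge[OF cI fcont continuous_on_subset[OF v_cont I0] x0I strict])
      (assumption, rule that)
  obtain L where L: "L \<ge> 0" "\<And>s t. s \<in> {0..x0 + d} \<Longrightarrow> t \<in> {0..x0 + d} \<Longrightarrow> \<bar>r s - r t\<bar> \<le> L * \<bar>s - t\<bar>"
    using recycling_rate_lipschitz[OF r] by blast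
  define q where "q n = N n * (x n - y n)" for n
  define \<pi> where "\<pi> n = p + (X + 2) * (x n - x0)" for n
  define \<Psi> where "\<Psi> n = \<rho> * (u (x n) - v (y n)) + (b * x n - r (x n)) * \<pi> n
      - (\<bar>b\<bar> + L) * \<bar>N n * (x n - y n)\<^sup>2\<bar> - c1 * max (\<pi> n) 0 + c * ((x n)\<^sup>2 - (y n)\<^sup>2)" for n
  have inside: "\<forall>\<^sub>F n in sequentially. z n \<in> {x0 - d<..<x0 + d}" if "z \<longlonglongrightarrow> x0" for z
    using that d(1) by (intro topological_tendstoD[OF that]) auto
  have "\<forall>\<^sub>F n in sequentially. \<Psi> n \<le> 0"
    using inside[OF lim(1)] inside[OF lim(2)]
  proof eventually_elim
    case (elim n)
    have pos: "x n > 0" "y n > 0" using elim d by auto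
    have "superjet u (x n) ((p - (X + 2) * x0 - N n * y n) + (X + 2 + N n) * x n) (X + 2 + N n)"
    proof (rule superjet_of_interior_max[OF elim(1), where A = 0])
      fix \<xi> assume "\<xi> \<in> {x0 - d..x0 + d}"
      then show "u \<xi> - (0 + (p - (X + 2) * x0 - N n * y n) * \<xi> + (X + 2 + N n) / 2 * \<xi>\<^sup>2) \<le>
          u (x n) - (0 + (p - (X + 2) * x0 - N n * y n) * x n + (X + 2 + N n) / 2 * (x n)\<^sup>2)"
        using max[of \<xi> "y n" n] mem(2)[of n]
        by (simp add: I_def f_def power2_eq_square field_simps)
    qed
    moreover have "(p - (X + 2) * x0 - N n * y n) + (X + 2 + N n) * x n = q n + \<pi> n"
      by (simp add: q_def \<pi>_def algebra_simps)
    ultimately have ju: "superjet u (x n) (q n + \<pi> n) (X + 2 + N n)" by simp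
    have "superjet (\<lambda>y. - v y) (y n) (- N n * x n + N n * y n) (N n)"
    proof (rule superjet_of_interior_max[OF elim(2), where A = 0])
      fix \<eta> assume "\<eta> \<in> {x0 - d..x0 + d}"
      then show "- v \<eta> - (0 + - N n * x n * \<eta> + N n / 2 * \<eta>\<^sup>2) \<le>
          - v (y n) - (0 + - N n * x n * y n + N n / 2 * (y n)\<^sup>2)"
        using max[of "x n" \<eta> n] mem(1)[of n]
        by (simp add: I_def power2_eq_square field_simps)
    qed
    moreover have "- N n * x n + N n * y n = - q n" by (simp add: q_def algebra_simps)
    ultimately have jv: "superjet (\<lambda>y. - v y) (y n) (- q n) (N n)" by simp
    have fu: "F (x n) (u (x n)) (q n + \<pi> n) \<le> 0" and fv: "0 \<le> F (y n) (v (y n)) (q n)"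
      using u_jet(2)[OF pos(1) ju] v_jet(2)[OF pos(2) jv] \<sigma> by auto
    have "ln (- ((q n + \<pi> n) - \<pi> n)) - ln (- (q n + \<pi> n)) \<le> c1 * max (\<pi> n) 0"
      using v_jet(1)[OF pos(2) jv] by (intro ln_slope_shift c1 u_jet(1)[OF pos(1) ju]) auto
    then have ln: "ln (- q n) - ln (- (q n + \<pi> n)) \<le> c1 * max (\<pi> n) 0" by simp
    have "\<bar>b * (x n - y n) - (r (x n) - r (y n))\<bar> \<le> \<bar>b\<bar> * \<bar>x n - y n\<bar> + L * \<bar>x n - y n\<bar>"
      using L(2)[of "x n" "y n"] mem[of n] I0 abs_mult[of b "x n - y n"]
      by (auto simp: I_def)
    then have "\<bar>b * (x n - y n) - (r (x n) - r (y n))\<bar> * \<bar>q n\<bar> \<le> ((\<bar>b\<bar> + L) * \<bar>x n - y n\<bar>) * \<bar>q n\<bar>"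
      by (intro mult_right_mono) (auto simp: algebra_simps)
    also have "\<dots> = (\<bar>b\<bar> + L) * \<bar>N n * (x n - y n)\<^sup>2\<bar>"
      by (simp add: q_def power2_eq_square abs_mult)
    finally have "\<bar>(b * (x n - y n) - (r (x n) - r (y n))) * q n\<bar>
        \<le> (\<bar>b\<bar> + L) * \<bar>N n * (x n - y n)\<^sup>2\<bar>"
      by (simp only: abs_mult)
    from abs_le_D2[OF this] ln
    have "\<Psi> n \<le> \<rho> * (u (x n) - v (y n)) + (b * x n - r (x n)) * \<pi> n
        + (b * (x n - y n) - (r (x n) - r (y n))) * q n
        + (ln (- (q n + \<pi> n)) - ln (- q n)) + c * ((x n)\<^sup>2 - (y n)\<^sup>2)"
      unfolding \<Psi>_def by argo
    also have "\<dots> = F (x n) (u (x n)) (q n + \<pi> n) - F (y n) (v (y n)) (q n)"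
      unfolding first_order_part_def by (simp only: algebra_simps)
    finally have "\<Psi> n \<le> F (x n) (u (x n)) (q n + \<pi> n) - F (y n) (v (y n)) (q n)" .
    with fu fv show ?case by linarith
  qed
  moreover have "\<Psi> \<longlonglongrightarrow> \<rho> * (u x0 - v x0) + (b * x0 - r x0) * (p + (X + 2) * (x0 - x0))
      - (\<bar>b\<bar> + L) * \<bar>0\<bar> - c1 * max (p + (X + 2) * (x0 - x0)) 0 + c * (x0\<^sup>2 - x0\<^sup>2)"
    unfolding \<Psi>_def \<pi>_def using isCont_coefficients[OF x0]
    by (intro tendsto_intros lim isCont_tendsto_compose[of _ u] isCont_tendsto_compose[of _ v]
        isCont_tendsto_compose[of _ r])
  ultimately have "\<rho> * (u x0 - v x0) + (b * x0 - r x0) * (p + (X + 2) * (x0 - x0))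
      - (\<bar>b\<bar> + L) * \<bar>0\<bar> - c1 * max (p + (X + 2) * (x0 - x0)) 0 + c * (x0\<^sup>2 - x0\<^sup>2) \<le> 0"
    by (intro tendsto_upperbound[of \<Psi> _ sequentially 0]) auto
  then show ?thesis by simp
qed

text \<open>
  The linear inequality satisfied by \<open>u - v\<close> in the viscosity sense.
\<close>

lemma difference_jet:
  assumes "x0 > 0" and "superjet (\<lambda>y. u y - v y) x0 p X"
  shows "\<rho> * (u x0 - v x0) + (b * x0 - r x0) * p - c1 * max p 0 - \<sigma>\<^sup>2 / 2 * x0\<^sup>2 * X \<le> 0"
proof (cases "\<sigma> = 0")
  case True
  with difference_jet_first_order[OF True assms] show ?thesis by simp
next
  case False
  then show ?thesis using assms by (rule difference_jet_elliptic)
qed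

section \<open>Behaviour at the origin\<close>

text \<open>
  Near \<open>0\<close>, the equation makes the second-order part of subjets of \<open>v\<close> with slope at least \<open>p\<close> less
  than \<open>- \<eta> / (\<sigma>\<^sup>2 x\<^sup>2)\<close>, or rules them out if \<open>\<sigma> = 0\<close>. The function \<open>p x + \<kappa> ln x\<close> has larger slope
  than \<open>p\<close> and, for small \<open>\<kappa>\<close>, less negative curvature, so it cannot touch \<open>v\<close> from below. As the
  difference tends to \<open>\<infinity>\<close> at \<open>0\<close>, it is nonincreasing near \<open>0\<close>; finally \<open>\<kappa>\<close> tends to \<open>0\<close>.
\<close>

lemma supersolution_slope_at_origin:
  assumes p: "p < 0" and sub: "\<rho> * v 0 + ln (- p) + 1 < 0"
  shows "\<exists>\<delta>>0. \<forall>x\<in>{0<..<\<delta>}. v x \<le> v 0 + p * x"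
proof -
  define \<eta> where "\<eta> = - (\<rho> * v 0 + ln (- p) + 1)"
  have \<eta>: "\<eta> > 0" using sub by (simp add: \<eta>_def)
  have r0: "r 0 = 0" using r by (simp add: recycling_rate_def)
  define g where "g x = \<rho> * v x + \<bar>b * x - r x\<bar> * (- p) + ln (- p) + 1 + c * x\<^sup>2" for x
  have at0: "at 0 within {0..} = at_right (0::real)" by (rule at_within_Ici_at_right)
  have v0: "(v \<longlongrightarrow> v 0) (at_right 0)"
    using v_cont unfolding continuous_on_def at0[symmetric] by auto
  have "(r \<longlongrightarrow> r 0) (at_right 0)"
    using recycling_rate_continuous[OF r] unfolding continuous_on_def at0[symmetric] by auto
  then have "(g \<longlongrightarrow> \<rho> * v 0 + \<bar>b * 0 - r 0\<bar> * (- p) + ln (- p) + 1 + c * 0\<^sup>2) (at_right 0)"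
    unfolding g_def by (intro tendsto_intros v0) auto
  moreover have "\<rho> * v 0 + \<bar>b * 0 - r 0\<bar> * (- p) + ln (- p) + 1 + c * 0\<^sup>2 = - \<eta>"
    by (simp add: r0 \<eta>_def)
  ultimately have "(g \<longlongrightarrow> - \<eta>) (at_right 0)" by simp
  then have "\<forall>\<^sub>F x in at_right 0. g x < - \<eta> / 2" using \<eta> by (intro order_tendstoD) auto
  then obtain \<delta> where \<delta>: "\<delta> > 0" "\<And>x. 0 < x \<Longrightarrow> x < \<delta> \<Longrightarrow> g x < - \<eta> / 2"
    unfolding eventually_at_right_field by auto
  have curv: "\<sigma>\<^sup>2 / 2 * x\<^sup>2 * Y > \<eta> / 2"
    if x: "0 < x" "x < \<delta>" and q: "q \<le> - p" and jet: "superjet (\<lambda>y. - v y) x q Y" for x q Y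
  proof -
    have "0 < q" and F: "- (\<sigma>\<^sup>2 / 2 * x\<^sup>2 * Y) \<le> F x (v x) (- q)" using v_jet[OF x(1) jet] by auto
    have "(b * x - r x) * (- q) \<le> \<bar>b * x - r x\<bar> * q"
      using \<open>0 < q\<close> by (metis abs_ge_minus_self less_imp_le minus_mult_commute mult_right_mono)
    also have "\<dots> \<le> \<bar>b * x - r x\<bar> * (- p)" using q by (intro mult_left_mono) auto
    finally have "(b * x - r x) * (- q) \<le> \<bar>b * x - r x\<bar> * (- p)" .
    moreover have "ln q \<le> ln (- p)" using \<open>0 < q\<close> q by (intro ln_mono) auto
    ultimately have "F x (v x) (- q) \<le> g x" unfolding first_order_part_def g_def by simp
    then show ?thesis using F \<delta>(2)[OF x] by linarith
  qed
  \<comment> \<open>the jet at the touching point has the second-order term \<open>\<sigma>\<^sup>2 * \<kappa>\<close>, which has to stay below \<open>\<eta> / 2\<close>\<close>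
  define \<kappa>0 where "\<kappa>0 = \<eta> / (2 * (\<sigma>\<^sup>2 + 1))"
  have \<kappa>0: "\<kappa>0 > 0" using \<eta> by (simp add: \<kappa>0_def add_nonneg_pos)
  have mono: "v t - p * t - \<kappa> * ln t \<le> v s - p * s - \<kappa> * ln s"
    if \<kappa>: "0 < \<kappa>" "\<kappa> \<le> \<kappa>0" and st: "0 < s" "s < t" "t < \<delta>" for \<kappa> s t
  proof (rule ccontr)
    define h where "h x = v x - p * x - \<kappa> * ln x" for x
    assume "\<not> ?thesis"
    then have less: "h s < h t" by (simp add: h_def)
    have "filterlim h at_top (at_right 0)"
    proof -
      have "((\<lambda>x. v x - p * x) \<longlongrightarrow> v 0 - p * 0) (at_right 0)" by (intro tendsto_intros v0)
      moreover have "filterlim (\<lambda>x. \<kappa> * - ln x) at_top (at_right (0::real))"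
        using \<kappa> ln_at_0 by (intro filterlim_tendsto_pos_mult_at_top[OF tendsto_const])
          (auto simp: filterlim_uminus_at_top)
      ultimately have "filterlim (\<lambda>x. (v x - p * x) + \<kappa> * - ln x) at_top (at_right 0)"
        by (rule filterlim_tendsto_add_at_top)
      then show ?thesis by (simp add: h_def[abs_def])
    qed
    then have "\<forall>\<^sub>F x in at_right 0. h s < h x" by (simp add: filterlim_at_top_dense)
    moreover have "\<forall>\<^sub>F x in at_right 0. x \<in> {0<..<s}" using st(1) by (rule eventually_at_right_real)
    ultimately have "\<forall>\<^sub>F x in at_right 0. h s < h x \<and> x \<in> {0<..<s}" by (rule eventually_conj)
    then obtain s' where s': "h s < h s'" "0 < s'" "s' < s"
      using eventually_happens[of _ "at_right (0::real)"] by auto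
    have "continuous_on {s'..t} h"
      unfolding h_def using s' by (intro continuous_intros continuous_on_subset[OF v_cont]) auto
    then obtain z where z: "z \<in> {s'..t}" "\<And>x. x \<in> {s'..t} \<Longrightarrow> h z \<le> h x"
      using continuous_attains_inf[of "{s'..t}" h] s' st by auto
    have "h z \<le> h s" using z(2)[of s] s' st by auto
    then have zin: "s' < z" "z < t" using z(1) less s'(1)
      by (metis atLeastAtMost_iff leD less_le)+
    then have z0: "0 < z" "z < \<delta>" using s' st by auto
    define q where "q = - p - \<kappa> / z"
    have test: "superjet (\<lambda>x. - p * x - \<kappa> * ln x) z (- p - \<kappa> / z) (2 * \<kappa> / z\<^sup>2)"
    proof (rule superjet_of_second_derivative[where D = "\<kappa> / z\<^sup>2"])
      show "\<forall>\<^sub>F y in nhds z. ((\<lambda>x. - p * x - \<kappa> * ln x) has_real_derivative - p - \<kappa> / y) (at y)"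
        using eventually_nhds_in_open[of "{0<..}" z] z0
        by (auto elim!: eventually_mono intro!: derivative_eq_intros)
      show "((\<lambda>y. - p - \<kappa> / y) has_real_derivative \<kappa> / z\<^sup>2) (at z)"
        using z0 by (auto intro!: derivative_eq_intros simp: power2_eq_square)
      show "\<kappa> / z\<^sup>2 < 2 * \<kappa> / z\<^sup>2" using \<kappa> z0 by (simp add: divide_strict_right_mono)
    qed
    have "\<forall>\<^sub>F x in at z. x \<in> {s'<..<t}"
      using zin by (intro eventually_at_in_open') auto
    then have "\<forall>\<^sub>F x in at z. - v x - (- p * x - \<kappa> * ln x) \<le> - v z - (- p * z - \<kappa> * ln z)"
    proof eventually_elim
      case (elim x)
      then show ?case using z(2)[of x] by (simp add: h_def)
    qed
    then have jet: "superjet (\<lambda>x. - v x) z q (2 * \<kappa> / z\<^sup>2)"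
      unfolding q_def using test by (rule superjet_touch)
    have "q \<le> - p" using \<kappa> z0 by (simp add: q_def)
    from curv[OF z0 this jet] have "\<eta> / 2 < \<sigma>\<^sup>2 * \<kappa>" using z0 by simp
    also have "\<sigma>\<^sup>2 * \<kappa> \<le> (\<sigma>\<^sup>2 + 1) * \<kappa>0" using \<kappa> by (intro mult_mono) auto
    also have "\<dots> = \<eta> / 2"
    proof -
      have "k * (\<eta> / (2 * k)) = \<eta> / 2" if "k > 0" for k :: real using that by simp
      from this[of "\<sigma>\<^sup>2 + 1"] show ?thesis
        unfolding \<kappa>0_def using zero_le_power2[of \<sigma>] by linarith
    qed
    finally show False by simp
  qed
  have mono0: "v t - p * t \<le> v s - p * s" if st: "0 < s" "s < t" "t < \<delta>" for s t
  proof -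
    have "\<forall>\<^sub>F \<kappa> in at_right 0. \<kappa> \<in> {0<..<\<kappa>0}" using \<kappa>0 by (rule eventually_at_right_real)
    then have ev: "\<forall>\<^sub>F \<kappa> in at_right 0. v t - p * t - \<kappa> * ln t \<le> v s - p * s - \<kappa> * ln s"
    proof eventually_elim
      case (elim \<kappa>)
      then show ?case using st by (intro mono) auto
    qed
    have "((\<lambda>\<kappa>. v t - p * t - \<kappa> * ln t) \<longlongrightarrow> v t - p * t - 0 * ln t) (at_right 0)"
      "((\<lambda>\<kappa>. v s - p * s - \<kappa> * ln s) \<longlongrightarrow> v s - p * s - 0 * ln s) (at_right 0)"
      by (intro tendsto_intros)+
    from tendsto_le[OF _ this(2,1) ev] show ?thesis by simp
  qed
  have "v t \<le> v 0 + p * t" if t: "0 < t" "t < \<delta>" for t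
  proof -
    have "((\<lambda>s. v s - p * s) \<longlongrightarrow> v 0 - p * 0) (at_right 0)" by (intro tendsto_intros v0)
    moreover have "\<forall>\<^sub>F s in at_right 0. s \<in> {0<..<t}" using t(1) by (rule eventually_at_right_real)
    then have "\<forall>\<^sub>F s in at_right 0. v t - p * t \<le> v s - p * s"
    proof eventually_elim
      case (elim s)
      then show ?case using t by (intro mono0) auto
    qed
    ultimately have "v t - p * t \<le> v 0 - p * 0" by (rule tendsto_lowerbound) simp
    then show ?thesis by simp
  qed
  then show ?thesis using \<delta>(1) by auto
qed

text \<open>
  The subsolution excludes slopes \<open>p\<close> with \<open>\<rho> * u 0 + ln (- p) + 1 > 0\<close>, and the supersolution forces
  slopes \<open>p'\<close> with \<open>\<rho> * v 0 + ln (- p') + 1 < 0\<close>. If \<open>v 0 < u 0\<close>, both conditions hold for a whole range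
  of slopes, so there is room for the error of a flat \<open>\<psi>\<close>.
\<close>

lemma no_origin_max:
  assumes less: "v 0 < u 0" and "\<rho> > 0"
    and max: "\<forall>\<^sub>F y in at_right 0. u y - v y - \<psi> y \<le> u 0 - v 0 - \<psi> 0"
    and flat: "((\<lambda>y. (\<psi> y - \<psi> 0) / y) \<longlongrightarrow> 0) (at_right 0)"
  shows False
proof -
  define \<mu> where "\<mu> = \<rho> * (u 0 - v 0)"
  have \<mu>: "\<mu> > 0" using less \<open>\<rho> > 0\<close> by (simp add: \<mu>_def)
  \<comment> \<open>\<open>ln (- p)\<close> lies a quarter, \<open>ln (- p')\<close> half of the way from \<open>- 1 - \<rho> * u 0\<close> to \<open>- 1 - \<rho> * v 0\<close>\<close>
  define p where "p = - exp (- 1 - \<rho> * u 0 + \<mu> / 4)"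
  define p' where "p' = - exp (- 1 - \<rho> * u 0 + \<mu> / 2)"
  have neg: "p < 0" "p' < 0" and lt: "p' < p" using \<mu> by (auto simp: p_def p'_def)
  have "\<rho> * v 0 + ln (- p') + 1 < 0"
  proof -
    have "ln (- p') = - 1 - \<rho> * u 0 + \<mu> / 2" by (simp add: p'_def)
    moreover have "\<mu> = \<rho> * u 0 - \<rho> * v 0" by (simp add: \<mu>_def right_diff_distrib)
    ultimately show ?thesis using \<mu> by linarith
  qed
  from supersolution_slope_at_origin[OF neg(2) this]
  obtain \<delta> where \<delta>: "\<delta> > 0" "\<And>x. 0 < x \<Longrightarrow> x < \<delta> \<Longrightarrow> v x \<le> v 0 + p' * x" by auto
  have "\<forall>\<^sub>F y in at_right 0. (\<psi> y - \<psi> 0) / y < p - p'"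
    using flat lt by (intro order_tendstoD) auto
  moreover have "\<forall>\<^sub>F y in at_right 0. y \<in> {0<..<\<delta>}" using \<delta>(1) by (rule eventually_at_right_real)
  ultimately have "\<forall>\<^sub>F y in at_right 0. u y \<le> u 0 + p * y"
    using max
  proof eventually_elim
    case (elim y)
    then have "\<psi> y - \<psi> 0 \<le> (p - p') * y" by (simp add: field_simps)
    then show ?case using elim \<delta>(2)[of y] by (simp add: algebra_simps)
  qed
  moreover have "r 0 = 0" using r by (simp add: recycling_rate_def)
  ultimately have "\<rho> * u 0 + ln (- p) + 1 \<le> 0"
    by (intro subsolution_at_origin[OF u_sub neg(1)])
  then show False using \<mu> by (simp add: p_def)
qed

end

section \<open>The penalty and the comparison\<close>

text \<open>
  The quadratic \<open>f m = \<rho> + b * m - \<sigma>\<^sup>2 / 2 * (m * (m - 1))\<close> is the factor by which the linear operator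
  multiplies \<open>x powr m\<close>. It is positive on \<open>[0, 1]\<close> and vanishes at \<open>K = \<bar>k(\<sigma>)\<bar>\<close>; hence \<open>K > 1\<close> and, by
  concavity, \<open>f\<close> is positive on \<open>[0, K)\<close>.
\<close>

lemma exponent_below_critical:
  fixes b \<rho> \<sigma> q :: real
  assumes "b > 0" "\<rho> > 0" "\<sigma> \<ge> 0" and q: "ereal q < \<bar>critical_exponent b \<rho> \<sigma>\<bar>"
  shows "\<exists>m>1. q < m \<and> \<rho> + b * m - \<sigma>\<^sup>2 / 2 * (m * (m - 1)) > 0"
proof (cases "\<sigma> = 0")
  case True
  show ?thesis
    by (rule exI[of _ "max q 1 + 1"]) (use True assms(1,2) in \<open>auto intro!: add_pos_pos mult_pos_pos\<close>)
next
  case False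
  then have \<sigma>: "\<sigma>\<^sup>2 > 0" by simp
  define k where "k = (THE k. k < 0 \<and> k\<^sup>2 + (1 + 2 * b / \<sigma>\<^sup>2) * k - 2 * \<rho> / \<sigma>\<^sup>2 = 0)"
  have "2 * \<rho> / \<sigma>\<^sup>2 > 0" using \<sigma> assms(2) by simp
  from theI'[OF negative_root_unique[OF this, of "1 + 2 * b / \<sigma>\<^sup>2"]]
  have "k < 0 \<and> k\<^sup>2 + (1 + 2 * b / \<sigma>\<^sup>2) * k - 2 * \<rho> / \<sigma>\<^sup>2 = 0"
    unfolding k_def .
  then have k: "k < 0" "k\<^sup>2 + (1 + 2 * b / \<sigma>\<^sup>2) * k - 2 * \<rho> / \<sigma>\<^sup>2 = 0" by auto
  define K where "K = - k"
  have K: "K > 0" using k by (simp add: K_def)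
  have qK: "q < K" using q False k(1) unfolding critical_exponent_def k_def[symmetric] K_def by simp
  define f where "f m = \<rho> + b * m - \<sigma>\<^sup>2 / 2 * (m * (m - 1))" for m
  have "f K = - (\<sigma>\<^sup>2 / 2) * (k\<^sup>2 + (1 + 2 * b / \<sigma>\<^sup>2) * k - 2 * \<rho> / \<sigma>\<^sup>2)"
    using False by (simp add: f_def K_def power2_eq_square field_simps)
  then have fK: "f K = 0" using k(2) by simp
  have K1: "K > 1"
  proof (rule ccontr)
    assume "\<not> K > 1"
    then have "0 \<le> \<sigma>\<^sup>2 / 2 * (K * (1 - K))" using K by simp
    moreover have "0 < b * K" using K assms(1) by simp
    ultimately have "f K > 0" using assms(2) by (simp add: f_def algebra_simps)
    then show False using fK by simp
  qed
  define m where "m = (max q 1 + K) / 2"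
  have m: "1 < m" "q < m" "m < K" using qK K1 by (auto simp: m_def)
  \<comment> \<open>subtracting a multiple of \<open>f K = 0\<close> makes the linear term cancel\<close>
  have "f m = f m - m / K * f K" using fK by simp
  also have "\<dots> = \<rho> * ((K - m) / K) + \<sigma>\<^sup>2 / 2 * (m * (K - m))"
    using K by (simp add: f_def field_simps)
  also have "\<dots> > 0" using m K assms(2) \<sigma> by (intro add_pos_pos mult_pos_pos divide_pos_pos) auto
  finally show ?thesis using m by (auto simp: f_def)
qed

text \<open>
  For \<open>x \<ge> R\<close> the term \<open>x powr m\<close> absorbs the bounded part of the drift, which is of order
  \<open>x powr (m - 1)\<close>; for \<open>x < R\<close> the constant \<open>A\<close> does.
\<close>

lemma power_barrier_strict:
  fixes b \<rho> \<sigma> c1 m a :: real and r :: "real \<Rightarrow> real"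
  assumes "\<rho> > 0" "c1 > 0" "m > 1" "a \<ge> 0" and r: "\<And>x. x > 0 \<Longrightarrow> r x \<le> a"
    and \<kappa>: "\<rho> + b * m - \<sigma>\<^sup>2 / 2 * (m * (m - 1)) > 0"
  shows "\<exists>A\<ge>0. \<forall>x>0. \<rho> * (A + x powr m) + (b * x - r x - c1) * (m * x powr (m - 1))
    - \<sigma>\<^sup>2 / 2 * x\<^sup>2 * (m * (m - 1) * x powr (m - 2)) > 0"
proof -
  define \<kappa> where "\<kappa> = \<rho> + b * m - \<sigma>\<^sup>2 / 2 * (m * (m - 1))"
  have \<kappa>0: "\<kappa> > 0" using \<kappa> by (simp add: \<kappa>_def)
  define S where "S = (a + c1) * m"
  have S: "S > 0" using assms by (simp add: S_def)
  define R where "R = S / \<kappa>"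
  define A where "A = (S * R powr (m - 1) + 1) / \<rho>"
  have A: "\<rho> * A = S * R powr (m - 1) + 1" using assms(1) by (simp add: A_def)
  have A0: "A \<ge> 0" using S assms(1) by (simp add: A_def)
  have "\<rho> * (A + x powr m) + (b * x - r x - c1) * (m * x powr (m - 1))
    - \<sigma>\<^sup>2 / 2 * x\<^sup>2 * (m * (m - 1) * x powr (m - 2)) > 0" if x: "x > 0" for x
  proof -
    have p1: "x powr m = x * x powr (m - 1)" using x by (simp add: powr_mult_base)
    have p2: "x\<^sup>2 * x powr (m - 2) = x powr m"
      using x powr_add[of x 2 "m - 2"] by (simp add: powr_numeral)
    have "\<rho> * (A + x powr m) + (b * x - r x - c1) * (m * x powr (m - 1))
        - \<sigma>\<^sup>2 / 2 * x\<^sup>2 * (m * (m - 1) * x powr (m - 2))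
      = \<rho> * A + \<rho> * x powr m + b * m * (x * x powr (m - 1)) - (r x + c1) * m * x powr (m - 1)
        - \<sigma>\<^sup>2 / 2 * (m * (m - 1)) * (x\<^sup>2 * x powr (m - 2))"
      by (simp add: field_simps)
    also have "\<dots> = \<rho> * A + \<kappa> * x powr m - (r x + c1) * m * x powr (m - 1)"
      unfolding p2 p1[symmetric] by (simp add: \<kappa>_def algebra_simps)
    also have "\<dots> \<ge> \<rho> * A + \<kappa> * x powr m - S * x powr (m - 1)"
      using r[OF x] assms(3) by (simp add: S_def mult_right_mono)
    finally have low: "\<rho> * A + \<kappa> * x powr m - S * x powr (m - 1)
      \<le> \<rho> * (A + x powr m) + (b * x - r x - c1) * (m * x powr (m - 1))
        - \<sigma>\<^sup>2 / 2 * x\<^sup>2 * (m * (m - 1) * x powr (m - 2))" .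
    have "\<rho> * A + \<kappa> * x powr m - S * x powr (m - 1) > 0"
    proof (cases "R \<le> x")
      case True
      then have "S \<le> \<kappa> * x" using \<kappa>0 by (simp add: R_def field_simps)
      then have "S * x powr (m - 1) \<le> \<kappa> * x * x powr (m - 1)" by (intro mult_right_mono) auto
      moreover have "0 \<le> S * R powr (m - 1)" using S by simp
      ultimately show ?thesis unfolding A p1 by (simp add: mult.assoc)
    next
      case False
      then have "x powr (m - 1) \<le> R powr (m - 1)" using x assms(3) by (intro powr_mono2) auto
      then have "S * x powr (m - 1) \<le> S * R powr (m - 1)" using S by simp
      moreover have "0 \<le> \<kappa> * x powr m" using \<kappa>0 by simp
      ultimately show ?thesis unfolding A by linarith
    qed
    with low show ?thesis by linarith
  qed
  then show ?thesis using A0 by blast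
qed

lemma attains_max_on_half_line:
  fixes D :: "real \<Rightarrow> real"
  assumes cont: "continuous_on {0..} D" and far: "\<forall>\<^sub>F x in at_top. D x \<le> 0"
    and z: "z \<ge> 0" "D z > 0"
  obtains x0 where "x0 \<ge> 0" "D x0 > 0" "\<And>x. x \<ge> 0 \<Longrightarrow> D x \<le> D x0"
proof -
  obtain R where R: "\<And>x. x \<ge> R \<Longrightarrow> D x \<le> 0" using far by (auto simp: eventually_at_top_linorder)
  have "continuous_on {0..max R z} D" by (rule continuous_on_subset[OF cont]) auto
  then obtain x0 where x0: "x0 \<in> {0..max R z}" "\<And>x. x \<in> {0..max R z} \<Longrightarrow> D x \<le> D x0"
    using continuous_attains_sup[of "{0..max R z}" D] z(1)
    by (metis atLeastAtMost_iff compact_Icc empty_iff max.coboundedI2 order_refl)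
  have pos: "D x0 > 0" using x0(2)[of z] z by auto
  have "D x \<le> D x0" if "x \<ge> 0" for x
    using x0(2)[of x] R[of x] pos that by (cases "x \<le> max R z") force+
  then show thesis using that x0(1) pos by auto
qed

lemma power_dominates_growth:
  fixes q m \<epsilon> c2 B :: real
  assumes "\<epsilon> > 0" "q < m" "m > 0"
  shows "\<forall>\<^sub>F x in at_top. B + c2 * x powr q \<le> \<epsilon> * x powr m"
proof -
  have "((\<lambda>x. B * x powr (- m) + c2 * x powr (q - m)) \<longlongrightarrow> B * 0 + c2 * 0) at_top"
    using assms by (intro tendsto_intros tendsto_neg_powr filterlim_ident) auto
  then have "\<forall>\<^sub>F x in at_top. B * x powr (- m) + c2 * x powr (q - m) < \<epsilon>"
    using assms(1) by (intro order_tendstoD) auto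
  then show ?thesis
    using eventually_gt_at_top[of 0]
  proof eventually_elim
    case (elim x)
    have "(B * x powr (- m) + c2 * x powr (q - m)) * x powr m \<le> \<epsilon> * x powr m"
      using elim by (intro mult_right_mono) auto
    moreover have "(B * x powr (- m) + c2 * x powr (q - m)) * x powr m = B + c2 * x powr q"
      using elim by (simp add: distrib_right powr_add[symmetric] mult.assoc)
    ultimately show ?case by simp
  qed
qed

theorem theorem2:
  fixes b c \<rho> \<sigma> c1 c2 q :: real and r u v :: "real \<Rightarrow> real"
  assumes "b > 0" and "c > 0" and "\<rho> > 0" and "\<sigma> \<ge> 0"
    and "recycling_rate b \<rho> r"
    and "\<sigma>\<^sup>2 < \<rho> + 2 * b"
    and "continuous_on {0..} u"
    and "strict_antimono_on {0..} u"
    and "viscosity_subsolution b c \<rho> \<sigma> r {0..} u"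
    and "c1 > 0"
    and "viscosity_deriv_le {0<..} u (- (1 / c1))"
    and "continuous_on {0..} v"
    and "strict_antimono_on {0..} v"
    and "viscosity_supersolution b c \<rho> \<sigma> r {0<..} v"
    and "c2 > 0"
    and "ereal q < \<bar>critical_exponent b \<rho> \<sigma>\<bar>"
    and "\<forall>x\<ge>0. v x \<ge> - c2 * (1 + x powr q)"
  shows "\<forall>x\<ge>0. u x \<le> v x"
proof (rule ccontr)
  assume "\<not> ?thesis"
  then obtain z where z: "z \<ge> 0" "u z > v z" by auto
  interpret sub_super_pair b c \<rho> \<sigma> c1 r u v
    using assms by unfold_locales
  obtain m where m: "m > 1" "q < m" "\<rho> + b * m - \<sigma>\<^sup>2 / 2 * (m * (m - 1)) > 0"
    using exponent_below_critical[OF assms(1,3,4,16)] by blast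
  obtain a where a: "a \<ge> 0" "\<And>x. x \<ge> 0 \<Longrightarrow> r x \<le> a"
    using recycling_rate_bounded[OF assms(5)] by blast
  obtain A where A: "A \<ge> 0" "\<And>x. x > 0 \<Longrightarrow> \<rho> * (A + x powr m) + (b * x - r x - c1) * (m * x powr (m - 1))
    - \<sigma>\<^sup>2 / 2 * x\<^sup>2 * (m * (m - 1) * x powr (m - 2)) > 0"
    using power_barrier_strict[OF assms(3,10) m(1) a(1) _ m(3)] a(2) by (metis less_imp_le)
  \<comment> \<open>small enough that \<open>\<psi> z \<le> (u z - v z) / 2\<close>; the summand \<open>1\<close> only keeps the denominator positive\<close>
  define \<epsilon> where "\<epsilon> = (u z - v z) / (2 * (A + z powr m + 1))"
  have den: "A + z powr m + 1 > 0" using A(1) powr_ge_zero[of z m] by linarith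
  have \<epsilon>: "\<epsilon> > 0" using z den by (simp add: \<epsilon>_def)
  define \<psi> where "\<psi> x = \<epsilon> * (A + x powr m)" for x
  define D where "D x = u x - v x - \<psi> x" for x
  have "\<epsilon> * (A + z powr m + 1) = (u z - v z) / 2" using den by (simp add: \<epsilon>_def field_simps)
  then have Dz: "D z > 0" using z(2) \<epsilon> by (simp add: D_def \<psi>_def distrib_left)
  have Dcont: "continuous_on {0..} D"
    unfolding D_def \<psi>_def using m(1)
    by (intro continuous_intros continuous_on_powr' assms(7,12)) auto
  have m0: "m > 0" using m(1) by simp
  have far: "\<forall>\<^sub>F x in at_top. D x \<le> 0"
    using power_dominates_growth[OF \<epsilon> m(2) m0, of "u 0 + c2" c2] eventually_gt_at_top[of 0]
  proof eventually_elim
    case (elim x)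
    have "u x < u 0" using assms(8) elim by (auto simp: monotone_on_def)
    moreover have "- c2 * (1 + x powr q) \<le> v x" using assms(17) elim by simp
    moreover have "0 \<le> \<epsilon> * A" using \<epsilon> A(1) by simp
    ultimately show ?case using elim m(1) by (simp add: D_def \<psi>_def algebra_simps)
  qed
  obtain x0 where x0: "x0 \<ge> 0" "D x0 > 0" "\<And>x. x \<ge> 0 \<Longrightarrow> D x \<le> D x0"
    using attains_max_on_half_line[OF Dcont far z(1) Dz] by blast
  show False
  proof (cases "x0 = 0")
    case True
    show False
    proof (rule no_origin_max[of \<psi>])
      have "0 \<le> \<psi> 0" using \<epsilon> A(1) by (simp add: \<psi>_def)
      then show "v 0 < u 0" using x0(2) by (simp add: D_def True)
      show "\<forall>\<^sub>F y in at_right 0. u y - v y - \<psi> y \<le> u 0 - v 0 - \<psi> 0"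
        using eventually_at_right_less[of 0]
        by eventually_elim (use x0(3) in \<open>simp add: D_def True\<close>)
      have "\<forall>\<^sub>F y in at_right (0::real). 0 \<le> y"
        using eventually_at_right_less[of 0] by eventually_elim simp
      then have "((\<lambda>y. y powr (m - 1)) \<longlongrightarrow> 0) (at_right 0)"
        using m(1) by (intro tendsto_zero_powrI[OF tendsto_ident_at tendsto_const]) auto
      then have "((\<lambda>y. \<epsilon> * y powr (m - 1)) \<longlongrightarrow> \<epsilon> * 0) (at_right 0)"
        by (rule tendsto_mult[OF tendsto_const])
      moreover have "\<forall>\<^sub>F y in at_right 0. \<epsilon> * y powr (m - 1) = (\<psi> y - \<psi> 0) / y"
        using eventually_at_right_less[of 0]
      proof eventually_elim
        case (elim y)
        have "y powr m = y * y powr (m - 1)" using elim by (simp add: powr_mult_base)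
        then show ?case using elim by (simp add: \<psi>_def algebra_simps)
      qed
      ultimately show "((\<lambda>y. (\<psi> y - \<psi> 0) / y) \<longlongrightarrow> 0) (at_right 0)"
        using Lim_transform_eventually by fastforce
    qed (rule assms(3))
  next
    case False
    then have pos: "x0 > 0" using x0(1) by simp
    define \<pi> where "\<pi> = \<epsilon> * (m * x0 powr (m - 1))"
    define Y where "Y = \<epsilon> * (m * (m - 1) * x0 powr (m - 2))"
    define G where "G = \<rho> * \<psi> x0 + (b * x0 - r x0 - c1) * \<pi> - \<sigma>\<^sup>2 / 2 * x0\<^sup>2 * Y"
    have "G = \<epsilon> * (\<rho> * (A + x0 powr m) + (b * x0 - r x0 - c1) * (m * x0 powr (m - 1))
        - \<sigma>\<^sup>2 / 2 * x0\<^sup>2 * (m * (m - 1) * x0 powr (m - 2)))"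
      by (simp add: G_def \<psi>_def \<pi>_def Y_def algebra_simps)
    then have G: "G > 0" using \<epsilon> A(2)[OF pos] by simp
    have \<pi>: "\<pi> \<ge> 0" using \<epsilon> m(1) by (simp add: \<pi>_def)
    define s where "s = \<sigma>\<^sup>2 / 2 * x0\<^sup>2"
    have s: "s \<ge> 0" by (simp add: s_def)
    \<comment> \<open>\<open>X\<close> exceeds the second derivative \<open>Y\<close> of \<open>\<psi>\<close>, but by too little to use up the gap \<open>G\<close>\<close>
    define X where "X = Y + G / (s + 1)"
    have XY: "X > Y" using G s by (simp add: X_def)
    have "s * (G / (s + 1)) < G" using G s by (simp add: field_simps)
    then have sX: "s * X < s * Y + G" by (simp add: X_def distrib_left)
    have jet: "superjet \<psi> x0 (\<epsilon> * (m * x0 powr (m - 1))) X"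
    proof (rule superjet_of_second_derivative[where D = Y])
      show "\<forall>\<^sub>F y in nhds x0. (\<psi> has_real_derivative \<epsilon> * (m * y powr (m - 1))) (at y)"
        using eventually_nhds_in_open[of "{0<..}" x0] pos unfolding \<psi>_def[abs_def]
        by (auto elim!: eventually_mono intro!: derivative_eq_intros)
      show "((\<lambda>y. \<epsilon> * (m * y powr (m - 1))) has_real_derivative Y) (at x0)"
        using pos by (auto intro!: derivative_eq_intros simp: Y_def)
    qed (rule XY)
    have "\<forall>\<^sub>F y in at x0. y > 0"
      using eventually_at_in_open'[of "{0<..}" x0] pos by simp
    then have "\<forall>\<^sub>F y in at x0. (u y - v y) - \<psi> y \<le> (u x0 - v x0) - \<psi> x0"
      by eventually_elim (use x0(3) in \<open>simp add: D_def\<close>)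
    then have "superjet (\<lambda>y. u y - v y) x0 \<pi> X"
      using jet unfolding \<pi>_def by (rule superjet_touch)
    from difference_jet[OF pos this]
    have "\<rho> * (u x0 - v x0) + (b * x0 - r x0 - c1) * \<pi> - s * X \<le> 0"
      using \<pi> by (simp add: s_def algebra_simps)
    moreover have "\<rho> * \<psi> x0 < \<rho> * (u x0 - v x0)"
      using x0(2) assms(3) by (simp add: D_def)
    ultimately show False using sX G by (simp add: G_def s_def)
  qed
qed

end
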